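(* Let $\mathcal{F}$ be a 2-capturing construction scheme. If $\mathfrak{m}_{\mathcal{F}}>\omega_1$, then there are no Suslin trees.
   Context: Types: $\tau=\langle m_k,n_{k+1},r_{k+1}\rangle_{k\in\omega}$ with $m_0=1$, $n_{k+1}\ge2$, $m_k>r_{k+1}$, $m_{k+1}=r_{k+1}+(m_k-r_{k+1})n_{k+1}$, assumed good (each $r$ equals $r_k$ for infinitely many $k$). A construction scheme of type $\tau$ is a family $\mathcal{F}$ of nonempty finite subsets of $\omega_1$, cofinal under $\subseteq$, each of size some $m_k$, such that with $\mathcal{F}_k=\{F\in\mathcal{F}:|F|=m_k\}$: (i) for $E,F\in\mathcal{F}_k$, $E\cap F$ is an initial segment of both; (ii) each $F\in\mathcal{F}_{k+1}$ is $F_0\cup\dots\cup F_{n_{k+1}-1}$ with $F_i\in\mathcal{F}_k$ a $\Delta$-system with root $R(F)$, $|R(F)|=r_{k+1}$, $R(F)<F_0\setminus R(F)<\dots<F_{n_{k+1}-1}\setminus R(F)$. Let $\rho(\alpha,\beta)=\min\{k:\exists F\in\mathcal{F}_k\ \{\alpha,\beta\}\subseteq F\}$; $\|\alpha\|_k=|\{\xi<\alpha:\rho(\alpha,\xi)\le k\}|$, $\Delta(\alpha,\beta)=\min\{k:\|\alpha\|_k\ne\|\beta\|_k\}$. $\Xi_\alpha(0)=0$; for $k\ge1$ and $F\in\mathcal{F}_k$ containing $\alpha$, $\Xi_\alpha(k)=-1$ if $\alpha\in R(F)$, $=i$ if $\alpha\in F_i\setminus R(F)$. $D(a)$ is the $a$-th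 element of a finite set $D$ of ordinals. A family $\langle D_i\rangle_{i<n}$ of subsets of $\omega_1$ each of size $m$ forming a root-tail-tail $\Delta$-system (pairwise intersections equal a root $R$, $|R|=r$, $R<D_i\setminus R$, $D_0\setminus R<D_1\setminus R<\dots$) is captured at level $l$ if $\Xi_{D_i(a)}(l)=-1$ for $a<r$, $=i$ for $r\le a<m$, and $\rho(D_i(a),D_j(a))=l=\Delta(D_i(a),D_j(a))$ for $i<j<n$, $r\le a<m$. $\mathcal{F}$ is $n$-capturing if for every uncountable family $\mathcal{S}$ of finite subsets of $\omega_1$ there are infinitely many $l$ such that some $n$ members of $\mathcal{S}$ form a family captured at level $l$. $\mathfrak{m}(\mathbb{P})$ is the least $\kappa$ such that some $\kappa$ dense subsets of $\mathbb{P}$ are not all met by one filter; $\mathfrak{m}_{\mathcal{F}}$ is $\omega$ if $\mathcal{F}$ is not 2-capturing and otherwise $\min\{\mathfrak{m}(\mathbb{P}):\mathbb{P}\text{ ccc and }\mathbb{P}\Vdash\mathcal{F}\text{ is 2-capturing}\}$. A Suslin tree is a tree of height $\omega_1$ with countable levels and no uncountable chains or antichains. *)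

theory Defs
  imports "HOL-Library.Countable_Set_Type"
begin

unbundle cardinal_syntax

section \<open>The ordinal \<open>\<omega>\<^sub>1\<close>\<close>

typedef omega1 = "Field (cardSuc natLeq)"
proof -
  have "infinite (Field (cardSuc natLeq))"
    using cardSuc_finite[OF natLeq_Card_order] by (simp add: Field_natLeq)
  then show ?thesis
    using infinite_imp_nonempty by fast
qed

lemma cardSuc_natLeq_Well_order: "Well_order (cardSuc natLeq)"
  using cardSuc_Card_order[OF natLeq_Card_order] unfolding card_order_on_def by blast

instantiation omega1 :: wellorder
begin

definition "a \<le> b \<longleftrightarrow> (Rep_omega1 a, Rep_omega1 b) \<in> cardSuc natLeq" for a b :: omega1

definition "a < b \<longleftrightarrow> a \<le> b \<and> \<not> b \<le> a" for a b :: omega1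

instance
proof
  interpret wo_rel "cardSuc natLeq"
    using cardSuc_natLeq_Well_order unfolding wo_rel_def .
  fix x y z :: omega1
  show "x < y \<longleftrightarrow> x \<le> y \<and> \<not> y \<le> x" by (simp add: less_omega1_def)
  show "x \<le> x"
    using REFL Rep_omega1 by (auto simp: less_eq_omega1_def refl_on_def)
  show "x \<le> z" if "x \<le> y" "y \<le> z"
    using that TRANS unfolding less_eq_omega1_def trans_def by blast
  show "x = y" if "x \<le> y" "y \<le> x"
    using that ANTISYM unfolding less_eq_omega1_def antisym_def
    by (metis Rep_omega1_inject)
  show "x \<le> y \<or> y \<le> x"
    using TOTALS Rep_omega1 unfolding less_eq_omega1_def by blast
next
  fix Q :: "omega1 \<Rightarrow> bool" and a :: omega1
  assume step: "\<And>x. (\<And>y. y < x \<Longrightarrow> Q y) \<Longrightarrow> Q x"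
  have wf: "wf (cardSuc natLeq - Id)"
    using cardSuc_natLeq_Well_order unfolding well_order_on_def by blast
  have "{(x, y). x < y} \<subseteq> inv_image (cardSuc natLeq - Id) Rep_omega1"
    by (auto simp: less_omega1_def less_eq_omega1_def Rep_omega1_inject)
  then have "wf {(x, y :: omega1). x < y}"
    using wf_subset[OF wf_inv_image[OF wf]] by blast
  then show "Q a"
    by (induction a rule: wf_induct_rule) (use step in auto)
qed

end

lemma uncountable_omega1: "uncountable (UNIV :: omega1 set)"
proof
  assume "countable (UNIV :: omega1 set)"
  then have "countable (range Rep_omega1)" by simp
  then have "countable (Field (cardSuc natLeq))"
    using type_definition.Rep_range[OF type_definition_omega1] by simp
  then have "|Field (cardSuc natLeq)| \<le>o natLeq"
    by (simp add: countable_card_le_natLeq)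
  then have "cardSuc natLeq \<le>o natLeq"
    using card_of_Field_ordIso[OF cardSuc_Card_order[OF natLeq_Card_order]]
    by (meson ordIso_ordLeq_trans ordIso_symmetric)
  then show False
    using cardSuc_greater[OF natLeq_Card_order] not_ordLess_ordLeq by blast
qed

lemma countable_below_omega1: "countable {..< a :: omega1}"
proof -
  let ?u = "underS (cardSuc natLeq) (Rep_omega1 a)"
  have "|?u| <o cardSuc natLeq"
    by (rule card_of_underS[OF cardSuc_Card_order[OF natLeq_Card_order] Rep_omega1])
  then have "|?u| \<le>o natLeq"
    using cardSuc_ordLeq_ordLess[OF natLeq_Card_order card_of_Card_order] by blast
  then have "countable ?u" by (simp add: countable_card_le_natLeq)
  moreover have "Rep_omega1 ` {..<a} \<subseteq> ?u"
    by (auto simp: underS_def less_omega1_def less_eq_omega1_def Rep_omega1_inject)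
  ultimately have "countable (Rep_omega1 ` {..<a})" by (rule countable_subset[rotated])
  then show ?thesis
    using countable_image_inj_eq inj_on_def Rep_omega1_inject by metis
qed


section \<open>Construction schemes\<close>

text \<open>A type is given by three sequences \<^term>\<open>m\<close>, \<^term>\<open>n\<close>, \<^term>\<open>r\<close>; the values
  \<open>n 0\<close> and \<open>r 0\<close> are never used.\<close>

definition scheme_type :: "(nat \<Rightarrow> nat) \<Rightarrow> (nat \<Rightarrow> nat) \<Rightarrow> (nat \<Rightarrow> nat) \<Rightarrow> bool" where
  "scheme_type m n r \<longleftrightarrow> m 0 = 1 \<and>
     (\<forall>k. n (Suc k) \<ge> 2 \<and> m k > r (Suc k) \<and>
          m (Suc k) = r (Suc k) + (m k - r (Suc k)) * n (Suc k))"

definition good_type :: "(nat \<Rightarrow> nat) \<Rightarrow> bool" where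
  "good_type r \<longleftrightarrow> (\<forall>s. infinite {k. r (Suc k) = s})"

definition set_less :: "'a::ord set \<Rightarrow> 'a set \<Rightarrow> bool" where
  "set_less A B \<longleftrightarrow> (\<forall>a\<in>A. \<forall>b\<in>B. a < b)"

definition initial_segment :: "'a::ord set \<Rightarrow> 'a set \<Rightarrow> bool" where
  "initial_segment I E \<longleftrightarrow> I \<subseteq> E \<and> (\<forall>x\<in>I. \<forall>y\<in>E. y < x \<longrightarrow> y \<in> I)"

definition level :: "(nat \<Rightarrow> nat) \<Rightarrow> omega1 set set \<Rightarrow> nat \<Rightarrow> omega1 set set" where
  "level m \<F> k = {F \<in> \<F>. card F = m k}"

text \<open>\<open>delta_system N G R\<close>: the sets \<open>G 0, \<dots>, G (N - 1)\<close> form a root-tail-tail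
  \<open>\<Delta>\<close>-system with root \<open>R\<close>.\<close>

definition delta_system :: "nat \<Rightarrow> (nat \<Rightarrow> omega1 set) \<Rightarrow> omega1 set \<Rightarrow> bool" where
  "delta_system N G R \<longleftrightarrow>
     (\<forall>i<N. R \<subseteq> G i \<and> set_less R (G i - R)) \<and>
     (\<forall>i<N. \<forall>j<N. i \<noteq> j \<longrightarrow> G i \<inter> G j = R) \<and>
     (\<forall>i<N. \<forall>j<N. i < j \<longrightarrow> set_less (G i - R) (G j - R))"

text \<open>\<open>decomposition m n r \<F> k F G R\<close>, for \<open>F\<close> of level \<open>k + 1\<close>: \<open>R\<close> is \<open>R(F)\<close> and
  \<open>G i\<close> is \<open>F\<^sub>i\<close>.\<close>

definition decomposition ::
  "(nat \<Rightarrow> nat) \<Rightarrow> (nat \<Rightarrow> nat) \<Rightarrow> (nat \<Rightarrow> nat) \<Rightarrow> omega1 set set \<Rightarrow> nat \<Rightarrow>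
   omega1 set \<Rightarrow> (nat \<Rightarrow> omega1 set) \<Rightarrow> omega1 set \<Rightarrow> bool" where
  "decomposition m n r \<F> k F G R \<longleftrightarrow>
     (\<forall>i<n (Suc k). G i \<in> level m \<F> k) \<and> F = (\<Union>i<n (Suc k). G i) \<and>
     delta_system (n (Suc k)) G R \<and> card R = r (Suc k)"

definition construction_scheme ::
  "(nat \<Rightarrow> nat) \<Rightarrow> (nat \<Rightarrow> nat) \<Rightarrow> (nat \<Rightarrow> nat) \<Rightarrow> omega1 set set \<Rightarrow> bool" where
  "construction_scheme m n r \<F> \<longleftrightarrow>
     (\<forall>F\<in>\<F>. finite F \<and> F \<noteq> {} \<and> (\<exists>k. card F = m k)) \<and>
     (\<forall>A. finite A \<longrightarrow> (\<exists>F\<in>\<F>. A \<subseteq> F)) \<and>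
     (\<forall>k. \<forall>E\<in>level m \<F> k. \<forall>F\<in>level m \<F> k.
        initial_segment (E \<inter> F) E \<and> initial_segment (E \<inter> F) F) \<and>
     (\<forall>k. \<forall>F\<in>level m \<F> (Suc k). \<exists>G R. decomposition m n r \<F> k F G R)"

definition rho :: "(nat \<Rightarrow> nat) \<Rightarrow> omega1 set set \<Rightarrow> omega1 \<Rightarrow> omega1 \<Rightarrow> nat" where
  "rho m \<F> \<alpha> \<beta> = (LEAST k. \<exists>F\<in>level m \<F> k. {\<alpha>, \<beta>} \<subseteq> F)"

definition scheme_norm :: "(nat \<Rightarrow> nat) \<Rightarrow> omega1 set set \<Rightarrow> omega1 \<Rightarrow> nat \<Rightarrow> nat" where
  "scheme_norm m \<F> \<alpha> k = card {\<xi>. \<xi> < \<alpha> \<and> rho m \<F> \<alpha> \<xi> \<le> k}"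

definition Delta :: "(nat \<Rightarrow> nat) \<Rightarrow> omega1 set set \<Rightarrow> omega1 \<Rightarrow> omega1 \<Rightarrow> nat" where
  "Delta m \<F> \<alpha> \<beta> = (LEAST k. scheme_norm m \<F> \<alpha> k \<noteq> scheme_norm m \<F> \<beta> k)"

definition Xi ::
  "(nat \<Rightarrow> nat) \<Rightarrow> (nat \<Rightarrow> nat) \<Rightarrow> (nat \<Rightarrow> nat) \<Rightarrow> omega1 set set \<Rightarrow> omega1 \<Rightarrow> nat \<Rightarrow> int" where
  "Xi m n r \<F> \<alpha> k =
     (case k of 0 \<Rightarrow> 0
      | Suc k' \<Rightarrow> (THE x. \<exists>F\<in>level m \<F> k. \<exists>G R. \<alpha> \<in> F \<and> decomposition m n r \<F> k' F G R \<and>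
          (\<alpha> \<in> R \<and> x = - 1 \<or> (\<exists>i<n k. \<alpha> \<in> G i - R \<and> x = int i))))"


section \<open>Capturing\<close>

text \<open>The \<open>a\<close>-th element of a finite set \<open>D\<close> is \<open>sorted_list_of_set D ! a\<close>.\<close>

definition captured ::
  "(nat \<Rightarrow> nat) \<Rightarrow> (nat \<Rightarrow> nat) \<Rightarrow> (nat \<Rightarrow> nat) \<Rightarrow> omega1 set set \<Rightarrow>
   nat \<Rightarrow> (nat \<Rightarrow> omega1 set) \<Rightarrow> nat \<Rightarrow> bool" where
  "captured m n r \<F> N D l \<longleftrightarrow>
     (\<exists>d e R. (\<forall>i<N. finite (D i) \<and> card (D i) = d) \<and> delta_system N D R \<and> card R = e \<and>
        (\<forall>i<N. \<forall>a<e. Xi m n r \<F> (sorted_list_of_set (D i) ! a) l = - 1) \<and>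
        (\<forall>i<N. \<forall>a. e \<le> a \<and> a < d \<longrightarrow> Xi m n r \<F> (sorted_list_of_set (D i) ! a) l = int i) \<and>
        (\<forall>i<N. \<forall>j<N. \<forall>a. i < j \<and> e \<le> a \<and> a < d \<longrightarrow>
           rho m \<F> (sorted_list_of_set (D i) ! a) (sorted_list_of_set (D j) ! a) = l \<and>
           Delta m \<F> (sorted_list_of_set (D i) ! a) (sorted_list_of_set (D j) ! a) = l))"

definition capturing ::
  "(nat \<Rightarrow> nat) \<Rightarrow> (nat \<Rightarrow> nat) \<Rightarrow> (nat \<Rightarrow> nat) \<Rightarrow> omega1 set set \<Rightarrow> nat \<Rightarrow> bool" where
  "capturing m n r \<F> N \<longleftrightarrow>
     (\<forall>S. (\<forall>s\<in>S. finite s) \<and> uncountable S \<longrightarrow>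
        infinite {l. \<exists>D. inj_on D {..<N} \<and> D ` {..<N} \<subseteq> S \<and> captured m n r \<F> N D l})"


section \<open>Forcing\<close>

text \<open>A forcing notion is a nonempty partial order \<open>P\<close> with set of conditions \<open>Field P\<close>;
  \<open>(q, p) \<in> P\<close> means \<open>q \<le> p\<close>, i.e. \<open>q\<close> is the stronger condition.\<close>

definition forcing_notion :: "'p rel \<Rightarrow> bool" where
  "forcing_notion P \<longleftrightarrow> Partial_order P \<and> Field P \<noteq> {}"

definition compat :: "'p rel \<Rightarrow> 'p \<Rightarrow> 'p \<Rightarrow> bool" where
  "compat P p q \<longleftrightarrow> (\<exists>s. (s, p) \<in> P \<and> (s, q) \<in> P)"

definition ccc :: "'p rel \<Rightarrow> bool" where
  "ccc P \<longleftrightarrow> (\<forall>A \<subseteq> Field P. pairwise (\<lambda>p q. \<not> compat P p q) A \<longrightarrow> countable A)"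

definition dense_in :: "'p rel \<Rightarrow> 'p set \<Rightarrow> bool" where
  "dense_in P D \<longleftrightarrow> D \<subseteq> Field P \<and> (\<forall>p\<in>Field P. \<exists>q\<in>D. (q, p) \<in> P)"

definition filter_in :: "'p rel \<Rightarrow> 'p set \<Rightarrow> bool" where
  "filter_in P G \<longleftrightarrow> G \<subseteq> Field P \<and> G \<noteq> {} \<and>
     (\<forall>p\<in>G. \<forall>q. (p, q) \<in> P \<longrightarrow> q \<in> G) \<and>
     (\<forall>p\<in>G. \<forall>q\<in>G. \<exists>s\<in>G. (s, p) \<in> P \<and> (s, q) \<in> P)"

text \<open>The forcing relation is defined by a shallow embedding: a formula of the forcing language
  is identified with the set of conditions forcing it. Only subsets of ground-model sets need
  names, and every subset of a ground-model set \<open>X\<close> in the extension is the evaluation of a name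
  \<open>S \<subseteq> P \<times> X\<close>; the pair \<open>(s, x) \<in> S\<close> puts the ground-model element \<open>x\<close> into the evaluation as
  soon as \<open>s\<close> is in the generic filter. Pairs whose first component is not a condition
  are irrelevant. \<open>fGround\<close> is for absolute statements about ground-model objects.\<close>

definition fMem :: "'p rel \<Rightarrow> ('p \<times> 'x) set \<Rightarrow> 'x \<Rightarrow> 'p \<Rightarrow> bool" where
  "fMem P S x p \<longleftrightarrow> (\<forall>q. (q, p) \<in> P \<longrightarrow> (\<exists>t s. (t, q) \<in> P \<and> (s, x) \<in> S \<and> (t, s) \<in> P))"

definition fGround :: "bool \<Rightarrow> 'p \<Rightarrow> bool" where
  "fGround b p \<longleftrightarrow> b"

definition fNot :: "'p rel \<Rightarrow> ('p \<Rightarrow> bool) \<Rightarrow> 'p \<Rightarrow> bool" where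
  "fNot P \<phi> p \<longleftrightarrow> (\<forall>q. (q, p) \<in> P \<longrightarrow> \<not> \<phi> q)"

definition fAnd :: "('p \<Rightarrow> bool) \<Rightarrow> ('p \<Rightarrow> bool) \<Rightarrow> 'p \<Rightarrow> bool" where
  "fAnd \<phi> \<psi> p \<longleftrightarrow> \<phi> p \<and> \<psi> p"

definition fAll :: "('x \<Rightarrow> 'p \<Rightarrow> bool) \<Rightarrow> 'p \<Rightarrow> bool" where
  "fAll \<Phi> p \<longleftrightarrow> (\<forall>x. \<Phi> x p)"

definition fImp :: "'p rel \<Rightarrow> ('p \<Rightarrow> bool) \<Rightarrow> ('p \<Rightarrow> bool) \<Rightarrow> 'p \<Rightarrow> bool" where
  "fImp P \<phi> \<psi> = fNot P (fAnd \<phi> (fNot P \<psi>))"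

definition fEx :: "'p rel \<Rightarrow> ('x \<Rightarrow> 'p \<Rightarrow> bool) \<Rightarrow> 'p \<Rightarrow> bool" where
  "fEx P \<Phi> = fNot P (fAll (\<lambda>x. fNot P (\<Phi> x)))"

definition forces :: "'p rel \<Rightarrow> ('p \<Rightarrow> bool) \<Rightarrow> bool" where
  "forces P \<phi> \<longleftrightarrow> (\<forall>p\<in>Field P. \<phi> p)"

text \<open>``There is an injective partial function \<open>f\<close> into \<open>\<omega>\<close> whose domain contains \<open>S\<close>'',
  where \<open>f\<close> ranges over names.\<close>

definition fCountable :: "'p rel \<Rightarrow> ('p \<times> 'x) set \<Rightarrow> 'p \<Rightarrow> bool" where
  "fCountable P S =
     fEx P (\<lambda>f :: ('p \<times> ('x \<times> nat)) set.
       fAnd (fAll (\<lambda>x. fImp P (fMem P S x) (fEx P (\<lambda>k. fMem P f (x, k)))))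
      (fAnd (fAll (\<lambda>x. fAll (\<lambda>k. fAll (\<lambda>k'.
               fImp P (fAnd (fMem P f (x, k)) (fMem P f (x, k'))) (fGround (k = k'))))))
            (fAll (\<lambda>x. fAll (\<lambda>y. fAll (\<lambda>k.
               fImp P (fAnd (fMem P f (x, k)) (fMem P f (y, k))) (fGround (x = y))))))))"

text \<open>``\<open>\<F>\<close> is \<open>N\<close>-capturing'' in the forcing language. A ccc extension preserves \<open>\<omega>\<^sub>1\<close>, has the
  same finite subsets of it, and \<open>captured\<close> is absolute, so only the uncountable family needs a name.\<close>

definition fCapturing ::
  "'p rel \<Rightarrow> (nat \<Rightarrow> nat) \<Rightarrow> (nat \<Rightarrow> nat) \<Rightarrow> (nat \<Rightarrow> nat) \<Rightarrow> omega1 set set \<Rightarrow> nat \<Rightarrow> 'p \<Rightarrow> bool" where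
  "fCapturing P m n r \<F> N =
     fAll (\<lambda>S :: ('p \<times> omega1 set) set.
       fImp P
         (fAnd (fAll (\<lambda>s. fImp P (fMem P S s) (fGround (finite s)))) (fNot P (fCountable P S)))
         (fAll (\<lambda>l\<^sub>0 :: nat. fEx P (\<lambda>l. fAnd (fGround (l\<^sub>0 < l))
           (fEx P (\<lambda>D. fAnd (fGround (inj_on D {..<N} \<and> captured m n r \<F> N D l))
                            (fAll (\<lambda>i. fImp P (fGround (i < N)) (fMem P S (D i))))))))))"


section \<open>Cardinal invariants\<close>

text \<open>Cardinals are represented by cardinal orders. \<open>is_m_poset P \<kappa>\<close> says that \<open>\<kappa>\<close> is \<open>\<mm>(P)\<close>;
  there is no such \<open>\<kappa>\<close> if some filter meets all dense subsets of \<open>P\<close>.\<close>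

definition unmet_families :: "'p rel \<Rightarrow> 'p set set set" where
  "unmet_families P = {\<D>. (\<forall>D\<in>\<D>. dense_in P D) \<and>
     \<not> (\<exists>G. filter_in P G \<and> (\<forall>D\<in>\<D>. G \<inter> D \<noteq> {}))}"

definition is_m_poset :: "'p rel \<Rightarrow> 'p set rel \<Rightarrow> bool" where
  "is_m_poset P \<kappa> \<longleftrightarrow> Card_order \<kappa> \<and>
     (\<exists>\<D>\<in>unmet_families P. \<kappa> =o |\<D>| ) \<and> (\<forall>\<D>\<in>unmet_families P. \<kappa> \<le>o |\<D>| )"

definition admissible ::
  "(nat \<Rightarrow> nat) \<Rightarrow> (nat \<Rightarrow> nat) \<Rightarrow> (nat \<Rightarrow> nat) \<Rightarrow> omega1 set set \<Rightarrow> 'p rel \<Rightarrow> bool" where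
  "admissible m n r \<F> P \<longleftrightarrow> forcing_notion P \<and> ccc P \<and> forces P (fCapturing P m n r \<F> 2)"

text \<open>\<open>is_m_scheme m n r \<F> \<kappa>\<close> says that \<open>\<kappa>\<close> is \<open>\<mm>\<^sub>\<F>\<close>, where the forcing notions range over those
  whose conditions are elements of the type \<^typ>\<open>'p\<close>. A formula of HOL cannot quantify over
  types, so \<^typ>\<open>'p\<close> has to be large enough: given \<open>\<omega>\<^sub>1\<close> dense subsets of \<open>P\<close>, the conditions
  in an elementary submodel of size \<open>\<omega>\<^sub>1\<close> again form a ccc forcing notion that forces \<open>\<F>\<close> to
  be 2-capturing, so any uncountable \<^typ>\<open>'p\<close> decides correctly whether \<open>\<mm>\<^sub>\<F> > \<omega>\<^sub>1\<close>. With
  \<^typ>\<open>'p\<close> of size at least the continuum, \<open>\<kappa>\<close> is \<open>\<mm>\<^sub>\<F>\<close> itself.\<close>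

definition is_m_scheme ::
  "(nat \<Rightarrow> nat) \<Rightarrow> (nat \<Rightarrow> nat) \<Rightarrow> (nat \<Rightarrow> nat) \<Rightarrow> omega1 set set \<Rightarrow> 'p set rel \<Rightarrow> bool" where
  "is_m_scheme m n r \<F> \<kappa> \<longleftrightarrow> Card_order \<kappa> \<and>
     (if capturing m n r \<F> 2
      then (\<exists>P :: 'p rel. admissible m n r \<F> P \<and> is_m_poset P \<kappa>) \<and>
           (\<forall>(P :: 'p rel) \<mu>. admissible m n r \<F> P \<and> is_m_poset P \<mu> \<longrightarrow> \<kappa> \<le>o \<mu>)
      else \<kappa> =o natLeq)"


section \<open>Suslin trees\<close>

definition is_tree :: "'t rel \<Rightarrow> bool" where
  "is_tree T \<longleftrightarrow> Partial_order T \<and>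
     (\<forall>t\<in>Field T. well_order_on (underS T t) (Restr T (underS T t)))"

text \<open>Ordinals are represented by well-orders; \<open>cardSuc natLeq\<close> is \<open>\<omega>\<^sub>1\<close>. The ordinals below
  \<^term>\<open>\<delta> :: 'o rel\<close> are all represented on the type \<^typ>\<open>'o\<close> of \<open>\<delta>\<close>.\<close>

definition tree_level :: "'t rel \<Rightarrow> 'o rel \<Rightarrow> 't set" where
  "tree_level T \<alpha> = {t \<in> Field T. Restr T (underS T t) =o \<alpha>}"

definition tree_height :: "'t rel \<Rightarrow> 'o rel \<Rightarrow> bool" where
  "tree_height T \<delta> \<longleftrightarrow> Well_order \<delta> \<and> tree_level T \<delta> = {} \<and>
     (\<forall>\<alpha> :: 'o rel. \<alpha> <o \<delta> \<longrightarrow> tree_level T \<alpha> \<noteq> {})"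

definition suslin_tree :: "'t rel \<Rightarrow> bool" where
  "suslin_tree T \<longleftrightarrow> is_tree T \<and> tree_height T (cardSuc natLeq) \<and>
     (\<forall>\<alpha> :: nat set rel. \<alpha> <o cardSuc natLeq \<longrightarrow> countable (tree_level T \<alpha>)) \<and>
     (\<forall>C \<in> Chains T. countable C) \<and>
     (\<forall>A \<subseteq> Field T. pairwise (\<lambda>s t. (s, t) \<notin> T) A \<longrightarrow> countable A)"

end

theory Submission
  imports Defs
begin

text \<open>Let \<open>T\<close> be a Suslin tree. Call a forcing notion capture-ccc if every uncountable family of pairs
  (condition, finite set) contains two pairs with compatible conditions and captured finite sets, at
  arbitrarily high levels; such a forcing is ccc and forces \<open>\<F>\<close> to be 2-capturing, so filters meet
  any \<open>\<omega>\<^sub>1\<close> dense sets. If \<open>T\<close> itself is capture-ccc, this yields an uncountable chain. Otherwise there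
  are uncountably many nodes \<open>t\<close> with finite sets \<open>s t\<close> such that nodes with captured sets are
  incomparable. Then the forcing with finite antichains of these nodes is capture-ccc, and yields an
  uncountable antichain. To see this, enlarge the finite set attached to an antichain \<open>p\<close> by the sets
  \<open>s t\<close> for \<open>t\<close> in \<open>p\<close>, the heights of the nodes in \<open>p\<close>, and the heights at which pairs of nodes
  in \<open>p\<close> branch. When two such sets are captured, corresponding nodes are incomparable by the
  choice of \<open>s\<close>, and non-corresponding ones because their branching heights either agree (root) or
  exceed all heights in the first antichain (tail).\<close>


section \<open>Countable and uncountable sets, and the ordinal omega_1\<close>

text \<open>The initial segments up to elements of \<open>A\<close> have a countable union; any
  \<open>b\<close> outside this union lies strictly above all of \<open>A\<close>.\<close>

lemma countable_bounded_omega1: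
  fixes A :: "omega1 set"
  assumes "countable A"
  obtains b where "\<And>a. a \<in> A \<Longrightarrow> a < b"
proof -
  have "countable {..a}" for a :: omega1
    using countable_below_omega1[of a] ivl_disj_un_singleton(2)[of a] by (metis countable_Un countable_empty countable_insert)
  then have "countable (\<Union>a\<in>A. {..a})"
    using assms by blast
  then obtain b where "b \<notin> (\<Union>a\<in>A. {..a})"
    using uncountable_omega1 by (metis UNIV_eq_I)
  then show thesis
    using that[of b] by (auto simp: not_le)
qed

lemma card_omega1: "|UNIV :: omega1 set| =o cardSuc natLeq"
proof -
  have "bij_betw Rep_omega1 UNIV (Field (cardSuc natLeq))"
    using type_definition.Rep_range[OF type_definition_omega1]
    by (auto simp: bij_betw_def inj_on_def Rep_omega1_inject)
  then have "|UNIV :: omega1 set| =o |Field (cardSuc natLeq)|"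
    using card_of_ordIso by blast
  then show ?thesis
    using card_of_Field_ordIso[OF cardSuc_Card_order[OF natLeq_Card_order]] ordIso_transitive by blast
qed

lemma uncountable_imp_omega1_ordLeq:
  assumes "uncountable A"
  shows "|UNIV :: omega1 set| \<le>o |A|"
proof -
  have "\<not> |A| \<le>o natLeq"
    using assms by (simp add: countable_card_le_natLeq)
  then have "natLeq <o |A|"
    using not_ordLeq_iff_ordLess natLeq_Well_order card_of_Well_order by blast
  then have "cardSuc natLeq \<le>o |A|"
    using cardSuc_least[OF natLeq_Card_order card_of_Card_order] by blast
  then show ?thesis
    using card_omega1 ordIso_ordLeq_trans by blast
qed

text \<open>Pigeonhole principle, used to make the members of an uncountable family agree in their
  finitary data.\<close>

lemma uncountable_fibre:
  fixes f :: "'a \<Rightarrow> 'b :: countable"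
  assumes "uncountable X"
  obtains v where "uncountable {x \<in> X. f x = v}"
proof -
  have "X = (\<Union>v. {x \<in> X. f x = v})" by auto
  moreover have "countable (\<Union>v. {x \<in> X. f x = v})" if "\<And>v. countable {x \<in> X. f x = v}"
    using that by blast
  ultimately show thesis
    using that assms by auto
qed

lemma uncountable_image_inj_on:
  assumes "uncountable (f ` X)"
  obtains Y where "Y \<subseteq> X" "inj_on f Y" "uncountable Y"
proof -
  obtain Y where "Y \<subseteq> X" "inj_on f Y" "f ` X = f ` Y"
    by (metis subset_image_inj subset_refl)
  then show thesis
    using that assms by (metis countable_image)
qed


section \<open>Subfamilies of captured pairs\<close>

text \<open>Index lists allow subsets of different sets \<open>D\<close> to be compared: equal lists
  mean the same places in the increasing enumerations. Their type is countable, so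
  \<open>uncountable_fibre\<close> can fix them.\<close>

definition positions :: "omega1 set \<Rightarrow> omega1 set \<Rightarrow> nat list" where
  "positions D A = filter (\<lambda>a. sorted_list_of_set D ! a \<in> A) [0..<card D]"

lemma sorted_list_of_subset:
  assumes "finite D" "A \<subseteq> D"
  shows "sorted_list_of_set A = map (nth (sorted_list_of_set D)) (positions D A)"
proof -
  let ?L = "sorted_list_of_set D"
  have "map (nth ?L) [0..<card D] = ?L"
    using map_nth[of ?L] by simp
  then have *: "map (nth ?L) (positions D A) = filter (\<lambda>v. v \<in> A) ?L"
    using filter_map[of "\<lambda>v. v \<in> A" "nth ?L" "[0..<card D]"] by (simp add: positions_def o_def)
  have "sorted_list_of_set A = filter (\<lambda>v. v \<in> A) ?L"
  proof (rule sorted_distinct_set_unique)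
    show "set (sorted_list_of_set A) = set (filter (\<lambda>v. v \<in> A) ?L)"
      using assms finite_subset[of A D] by auto
  qed (auto simp: sorted_wrt_filter)
  then show ?thesis using * by simp
qed

text \<open>The increasing enumeration of \<open>D\<close> is that of \<open>R\<close> followed by
  that of \<open>D - R\<close>.\<close>

lemma nth_sorted_list_root_iff:
  assumes "finite D" "R \<subseteq> D" "set_less R (D - R)" "a < card D"
  shows "sorted_list_of_set D ! a \<in> R \<longleftrightarrow> a < card R"
    and "a < card R \<Longrightarrow> sorted_list_of_set D ! a = sorted_list_of_set R ! a"
proof -
  have fin: "finite R" "finite (D - R)"
    using assms finite_subset by auto
  let ?M = "sorted_list_of_set R @ sorted_list_of_set (D - R)"
  have eq: "sorted_list_of_set D = ?M"
  proof (rule sorted_distinct_set_unique)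
    show "sorted ?M"
      using assms(3) fin by (auto simp: sorted_append set_less_def less_imp_le)
    show "distinct ?M" "set (sorted_list_of_set D) = set ?M"
      using assms fin by auto
  qed auto
  show "a < card R \<Longrightarrow> sorted_list_of_set D ! a = sorted_list_of_set R ! a"
    by (simp add: eq nth_append)
  have cd: "card (D - R) = card D - card R"
    using assms fin card_Diff_subset by blast
  show "sorted_list_of_set D ! a \<in> R \<longleftrightarrow> a < card R"
  proof
    assume "sorted_list_of_set D ! a \<in> R"
    show "a < card R"
    proof (rule ccontr)
      assume "\<not> a < card R"
      then have "sorted_list_of_set D ! a \<in> set (sorted_list_of_set (D - R))"
        using assms(4) cd by (auto simp: eq nth_append simp del: sorted_list_of_set.set_sorted_key_list_of_set intro!: nth_mem)
      then show False
        using \<open>sorted_list_of_set D ! a \<in> R\<close> fin by simp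
    qed
  next
    assume "a < card R"
    then have "sorted_list_of_set R ! a \<in> set (sorted_list_of_set R)"
      by (intro nth_mem) simp
    then show "sorted_list_of_set D ! a \<in> R"
      using \<open>a < card R\<close> fin by (simp add: eq nth_append)
  qed
qed

lemma positions_singleton:
  assumes "finite D" "v \<in> D"
  obtains a where "positions D {v} = [a]" "a < card D" "sorted_list_of_set D ! a = v"
proof -
  have "map (nth (sorted_list_of_set D)) (positions D {v}) = [v]"
    using sorted_list_of_subset[of D "{v}"] assms by simp
  then obtain a where a: "positions D {v} = [a]" "sorted_list_of_set D ! a = v"
    by auto
  have "a \<in> set (positions D {v})" using a(1) by simp
  then have "a < card D" by (simp add: positions_def)
  then show thesis using that a by blast
qed

text \<open>The common position is below \<open>card R\<close> because \<open>v'\<close> is in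
  \<open>R\<close>, and there both enumerations follow that of \<open>R\<close>.\<close>

lemma positions_root:
  assumes D: "finite D" "R \<subseteq> D" "set_less R (D - R)" "v \<in> D"
    and D': "finite D'" "R \<subseteq> D'" "set_less R (D' - R)" "v' \<in> D'"
    and pos: "positions D {v} = positions D' {v'}" and "v' \<in> R"
  shows "v = v'"
proof -
  obtain a where a: "positions D {v} = [a]" "a < card D" "sorted_list_of_set D ! a = v"
    by (rule positions_singleton[OF D(1,4)])
  obtain b where "positions D' {v'} = [b]" "b < card D'" "sorted_list_of_set D' ! b = v'"
    by (rule positions_singleton[OF D'(1,4)])
  then have b: "a < card D'" "sorted_list_of_set D' ! a = v'"
    using pos a(1) by auto
  then have "a < card R"
    using nth_sorted_list_root_iff(1)[OF D'(1-3) b(1)] \<open>v' \<in> R\<close> by simp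
  then show ?thesis
    using nth_sorted_list_root_iff(2)[OF D(1-3) a(2)] nth_sorted_list_root_iff(2)[OF D'(1-3) b(1)] a(3) b(2)
    by simp
qed

text \<open>The clauses of \<open>captured\<close> on \<open>Xi\<close>, \<open>rho\<close> and
  \<open>Delta\<close> treat one index at a time, so they survive restriction to the indices in
  \<open>ps\<close>. What remains is to identify the new root and where it ends.\<close>

lemma captured_sub:
  assumes cap: "captured m n r \<F> N D l"
    and sub: "\<And>i. i < N \<Longrightarrow> A i \<subseteq> D i"
    and pos: "\<And>i. i < N \<Longrightarrow> positions (D i) (A i) = ps"
    and N: "2 \<le> N"
  shows "captured m n r \<F> N A l"
proof -
  from cap obtain d e R where
    D: "\<forall>i<N. finite (D i) \<and> card (D i) = d"
    and ds: "delta_system N D R" and e: "card R = e"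
    and Xi1: "\<forall>i<N. \<forall>a<e. Xi m n r \<F> (sorted_list_of_set (D i) ! a) l = - 1"
    and Xi2: "\<forall>i<N. \<forall>a. e \<le> a \<and> a < d \<longrightarrow> Xi m n r \<F> (sorted_list_of_set (D i) ! a) l = int i"
    and rd: "\<forall>i<N. \<forall>j<N. \<forall>a. i < j \<and> e \<le> a \<and> a < d \<longrightarrow>
           rho m \<F> (sorted_list_of_set (D i) ! a) (sorted_list_of_set (D j) ! a) = l \<and>
           Delta m \<F> (sorted_list_of_set (D i) ! a) (sorted_list_of_set (D j) ! a) = l"
    unfolding captured_def by (elim exE conjE) (rule that)
  have fin: "finite (D i)" and d: "card (D i) = d" if "i < N" for i
    using D that by auto
  have R: "R \<subseteq> D i" "set_less R (D i - R)" if "i < N" for i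
    using ds that unfolding delta_system_def by blast+
  have less: "set_less (D i - R) (D j - R)" if "i < j" "j < N" for i j
    using ds that order.strict_trans unfolding delta_system_def by blast
  have inter: "D i \<inter> D j = R" if "i \<noteq> j" "i < N" "j < N" for i j
    using ds that unfolding delta_system_def by blast
  have finA: "finite (A i)" if "i < N" for i
    using fin sub finite_subset that by blast
  have sl: "sorted_list_of_set (A i) = map (nth (sorted_list_of_set (D i))) ps" if "i < N" for i
    using sorted_list_of_subset[OF fin sub] pos that by metis
  have cA: "card (A i) = length ps" if "i < N" for i
    by (metis length_map sl sorted_list_of_set.length_sorted_key_list_of_set that)
  have psd: "b < d" if "b \<in> set ps" for b
    using pos[of 0] d[of 0] N that by (auto simp: positions_def)
  have A_mem: "v \<in> A i \<longleftrightarrow> (\<exists>a\<in>set ps. v = sorted_list_of_set (D i) ! a)" if "i < N" for i v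
    using arg_cong[OF sl[OF that], of set] finA[OF that] by auto
  have in_R: "sorted_list_of_set (D i) ! a \<in> R \<longleftrightarrow> a < e"
    "a < e \<Longrightarrow> sorted_list_of_set (D i) ! a = sorted_list_of_set R ! a" if "i < N" "a < d" for i a
    using nth_sorted_list_root_iff[OF fin R] that d[OF that(1)] e by simp_all
  \<comment> \<open>At indices below \<open>e\<close> all \<open>D i\<close> have the same elements,
    so the trace of \<open>R\<close> on \<open>A i\<close> does not depend on \<open>i\<close>;
    index 0 is a representative.\<close>
  define R' where "R' = R \<inter> A 0"
  have R'_A: "R \<inter> A i = R'" if "i < N" for i
  proof -
    have "v \<in> A k" if v: "v \<in> A j" "v \<in> R" and jk: "j < N" "k < N" for v j k
    proof -
      obtain a where a: "a \<in> set ps" "v = sorted_list_of_set (D j) ! a"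
        using A_mem[OF jk(1)] v(1) by blast
      then have "a < e" using in_R(1)[OF jk(1) psd] v(2) by blast
      then have "v = sorted_list_of_set (D k) ! a"
        using in_R(2)[OF jk(1) psd] in_R(2)[OF jk(2) psd] a by metis
      then show ?thesis using A_mem[OF jk(2)] a(1) by blast
    qed
    moreover have "0 < N" using N by simp
    ultimately show ?thesis using that unfolding R'_def by blast
  qed
  have ds': "delta_system N A R'"
    unfolding delta_system_def
  proof (intro conjI allI impI)
    fix i assume i: "i < N"
    show "R' \<subseteq> A i" using R'_A[OF i] by blast
    show "set_less R' (A i - R')"
      using R[OF i] sub[OF i] R'_A[OF i] unfolding set_less_def by blast
    fix j assume j: "j < N"
    show "A i \<inter> A j = R'" if "i \<noteq> j"
      using inter[OF that i j] sub[OF i] sub[OF j] R'_A[OF i] R'_A[OF j] by blast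
    show "set_less (A i - R') (A j - R')" if "i < j"
      using less[OF that j] sub[OF i] sub[OF j] R'_A[OF i] R'_A[OF j] unfolding set_less_def by blast
  qed
  \<comment> \<open>Root elements come first in both enumerations, so the bound \<open>e\<close> for
    indices in \<open>D i\<close> turns into the bound \<open>card R'\<close> for indices in
    \<open>A i\<close>.\<close>
  have ps_iff: "ps ! b < e \<longleftrightarrow> b < card R'" if "b < length ps" for b
  proof -
    have 0: "0 < N" using N by simp
    have "R' \<subseteq> A 0" "set_less R' (A 0 - R')"
      using ds' 0 unfolding delta_system_def by blast+
    then have "sorted_list_of_set (A 0) ! b \<in> R' \<longleftrightarrow> b < card R'"
      using nth_sorted_list_root_iff(1)[OF finA[OF 0]] cA[OF 0] that by metis
    moreover have "sorted_list_of_set (A 0) ! b \<in> A 0"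
      using that finA[OF 0] cA[OF 0] nth_mem[of b "sorted_list_of_set (A 0)"] by simp
    moreover have "sorted_list_of_set (A 0) ! b = sorted_list_of_set (D 0) ! (ps ! b)"
      using sl[OF 0] that by simp
    moreover have "ps ! b < d" using psd that by simp
    ultimately show ?thesis using in_R(1)[OF 0] R'_def by (metis IntD1 IntI)
  qed
  show ?thesis
    unfolding captured_def
  proof (intro exI conjI allI impI)
    show "delta_system N A R'" by (fact ds')
    show "card R' = card R'" ..
    have cardR': "card R' \<le> length ps"
      using card_mono[of "A 0" R'] finA[of 0] cA[of 0] N by (simp add: R'_def)
    fix i assume i: "i < N"
    show "finite (A i)" "card (A i) = length ps" using finA cA i by auto
    show "Xi m n r \<F> (sorted_list_of_set (A i) ! b) l = - 1" if "b < card R'" for b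
      using that ps_iff[of b] cardR' Xi1 i by (simp add: sl[OF i])
    show "Xi m n r \<F> (sorted_list_of_set (A i) ! b) l = int i" if "card R' \<le> b \<and> b < length ps" for b
      using that ps_iff[of b] Xi2 i psd[of "ps ! b"] by (simp add: sl[OF i])
    fix j b assume j: "j < N" and b: "i < j \<and> card R' \<le> b \<and> b < length ps"
    have "e \<le> ps ! b" "ps ! b < d" using b ps_iff[of b] psd[of "ps ! b"] by auto
    then show "rho m \<F> (sorted_list_of_set (A i) ! b) (sorted_list_of_set (A j) ! b) = l"
      "Delta m \<F> (sorted_list_of_set (A i) ! b) (sorted_list_of_set (A j) ! b) = l"
      using rd i j b by (simp_all add: sl[OF i] sl[OF j])
  qed
qed

section \<open>Forcing notions preserving 2-capturing\<close>

text \<open>A family of pairs is given by the set \<open>X\<close> of its finite sets and a function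
  \<open>p\<close> to conditions. Hence the finite sets are distinct, while conditions may
  repeat.\<close>

definition capture_ccc ::
  "(nat \<Rightarrow> nat) \<Rightarrow> (nat \<Rightarrow> nat) \<Rightarrow> (nat \<Rightarrow> nat) \<Rightarrow> omega1 set set \<Rightarrow> 'p rel \<Rightarrow> bool" where
  "capture_ccc m n r \<F> P \<longleftrightarrow>
     (\<forall>X p l\<^sub>0. uncountable X \<and> (\<forall>x\<in>X. finite x \<and> p x \<in> Field P) \<longrightarrow>
        (\<exists>D l. l\<^sub>0 < l \<and> inj_on D {..<2} \<and> D ` {..<2} \<subseteq> X \<and> captured m n r \<F> 2 D l \<and>
           compat P (p (D 0)) (p (D (1 :: nat)))))"

lemma capture_cccD:
  fixes l\<^sub>0 :: nat
  assumes "capture_ccc m n r \<F> P" "uncountable X" "\<And>x. x \<in> X \<Longrightarrow> finite x \<and> p x \<in> Field P"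
  obtains D l where "l\<^sub>0 < l" "inj_on D {..<2}" "D ` {..<2} \<subseteq> X" "captured m n r \<F> 2 D l"
    "compat P (p (D 0)) (p (D (1 :: nat)))"
proof -
  have "uncountable X \<and> (\<forall>x\<in>X. finite x \<and> p x \<in> Field P)"
    using assms by blast
  from assms(1)[unfolded capture_ccc_def, rule_format, OF this, of l\<^sub>0] show thesis
    by (elim exE conjE) (rule that)
qed

text \<open>The members of an uncountable antichain are attached to singletons, which serve merely
  as distinct labels; the pair that capture-ccc yields then carries distinct compatible
  conditions.\<close>

lemma capture_ccc_imp_ccc:
  assumes "capture_ccc m n r \<F> P"
  shows "ccc P"
  unfolding ccc_def
proof (intro allI impI)
  fix A assume A: "A \<subseteq> Field P" "pairwise (\<lambda>p q. \<not> compat P p q) A"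
  show "countable A"
  proof (rule ccontr)
    assume "uncountable A"
    then obtain g :: "omega1 \<Rightarrow> _" where g: "inj g" "range g \<subseteq> A"
      using uncountable_imp_omega1_ordLeq by (metis card_of_ordLeq)
    let ?X = "range (\<lambda>a :: omega1. {a})"
    have "uncountable ?X"
      using uncountable_omega1 by (metis countable_image_inj_on inj_singleton)
    moreover have "finite x \<and> g (the_elem x) \<in> Field P" if "x \<in> ?X" for x
      using that g(2) A(1) by auto
    ultimately obtain D l where D: "inj_on D {..<2}" "D ` {..<2} \<subseteq> ?X"
      "compat P (g (the_elem (D 0))) (g (the_elem (D (1 :: nat))))"
      using capture_cccD[OF assms, of ?X "\<lambda>x. g (the_elem x)"] by metis
    have "D 0 \<noteq> D 1" using D(1) by (auto dest: inj_onD)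
    moreover obtain a b where "D 0 = {a}" "D 1 = {b}"
    proof -
      have "D 0 \<in> ?X" "D 1 \<in> ?X" using D(2) by auto
      then show thesis using that by blast
    qed
    ultimately have "g a \<noteq> g b" "compat P (g a) (g b)"
      using g(1) D(3) by (auto dest: injD)
    then show False
      using A(2) g(2) unfolding pairwise_def by blast
  qed
qed

text \<open>Being built from negations, the implication requires its conclusion only at some
  extension of each \<open>q\<close>; \<open>fImpI\<close> takes \<open>q\<close> itself.\<close>

lemma fImp_iff: "fImp P \<phi> \<psi> p \<longleftrightarrow> (\<forall>q. (q, p) \<in> P \<and> \<phi> q \<longrightarrow> (\<exists>s. (s, q) \<in> P \<and> \<psi> s))"
  by (auto simp: fImp_def fNot_def fAnd_def)

lemma fEx_iff: "fEx P \<Phi> p \<longleftrightarrow> (\<forall>q. (q, p) \<in> P \<longrightarrow> (\<exists>x s. (s, q) \<in> P \<and> \<Phi> x s))"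
  by (auto simp: fEx_def fNot_def fAll_def)

lemma Partial_order_refl: "Partial_order P \<Longrightarrow> p \<in> Field P \<Longrightarrow> (p, p) \<in> P"
  by (auto simp: partial_order_on_def preorder_on_def refl_on_def)

lemma Partial_order_trans: "Partial_order P \<Longrightarrow> (p, q) \<in> P \<Longrightarrow> (q, s) \<in> P \<Longrightarrow> (p, s) \<in> P"
  unfolding partial_order_on_def preorder_on_def by (meson transD)

lemma fImpI:
  assumes "Partial_order P" "\<And>q. (q, p) \<in> P \<Longrightarrow> \<phi> q \<Longrightarrow> \<psi> q"
  shows "fImp P \<phi> \<psi> p"
  unfolding fImp_iff using assms Partial_order_refl by (meson FieldI1)

lemma fExI:
  assumes "Partial_order P" "\<And>q. (q, p) \<in> P \<Longrightarrow> \<Phi> x q"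
  shows "fEx P \<Phi> p"
  unfolding fEx_iff using assms Partial_order_refl by (meson FieldI1)

lemma fMem_mono:
  assumes "trans P" "fMem P S x p" "(q, p) \<in> P"
  shows "fMem P S x q"
  using assms unfolding fMem_def by (meson transD)

text \<open>An injection of \<open>X\<close> into the natural numbers exists in the ground model,
  and its canonical name witnesses countability.\<close>

lemma fCountableI:
  fixes S :: "('p \<times> 'x) set"
  assumes po: "Partial_order P" and p: "p \<in> Field P"
    and X: "countable X" "\<And>x q. (q, p) \<in> P \<Longrightarrow> fMem P S x q \<Longrightarrow> x \<in> X"
  shows "fCountable P S p"
proof -
  note refl = Partial_order_refl[OF po] and tr = Partial_order_trans[OF po]
  \<comment> \<open>Every condition is paired with every element of the graph, so each condition
    forces exactly the ground-model facts about it; this is \<open>mem\<close>.\<close>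
  define f where "f = {(s, (x, to_nat_on X x)) | s x. s \<in> Field P \<and> x \<in> X}"
  have mem: "fMem P f (x, k) q \<longleftrightarrow> x \<in> X \<and> k = to_nat_on X x" if "q \<in> Field P" for x k q
    unfolding fMem_def f_def using refl that by (auto intro: FieldI1)
  have ran: "to_nat_on X x = to_nat_on X y \<longleftrightarrow> x = y" if "x \<in> X" "y \<in> X" for x y
    using inj_on_to_nat_on[OF X(1)] that by (auto dest: inj_onD)
  show ?thesis
    unfolding fCountable_def fAnd_def fAll_def
  proof (rule fExI[OF po, where x = f], intro conjI allI fImpI[OF po], goal_cases)
    case (1 q x s)
    then have "x \<in> X" using X(2) tr by blast
    then show ?case
      using mem by (intro fExI[OF po, where x = "to_nat_on X x"]) (auto intro: FieldI1)
  next
    case (2 q x k k' s)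
    then show ?case using mem[OF FieldI1, of s q] unfolding fGround_def by metis
  next
    case (3 q x y k s)
    then have "s \<in> Field P" by (meson FieldI1)
    then show ?case using 3 mem[of s] ran unfolding fGround_def by metis
  qed
qed

text \<open>Capture-ccc is applied to the ground-model sets that some extension of \<open>q\<close>
  forces into \<open>S\<close>, each with such an extension. A common extension of the two
  conditions obtained forces both captured sets into \<open>S\<close>.\<close>

lemma capture_ccc_imp_forces:
  assumes po: "Partial_order P" and cap: "capture_ccc m n r \<F> P"
  shows "forces P (fCapturing P m n r \<F> 2)"
proof -
  have trP: "trans P"
    using po by (auto simp: partial_order_on_def preorder_on_def)
  note tr = Partial_order_trans[OF po]
  have "\<exists>l s. (s, q) \<in> P \<and> l\<^sub>0 < l \<and>
      fEx P (\<lambda>D. fAnd (fGround (inj_on D {..<2} \<and> captured m n r \<F> 2 D l))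
        (fAll (\<lambda>i. fImp P (fGround (i < 2)) (fMem P S (D i))))) s"
    if p: "(p, p\<^sub>0) \<in> P" and q: "(q, p) \<in> P"
      and fin: "\<And>x q. (q, p) \<in> P \<Longrightarrow> fMem P S x q \<Longrightarrow> \<exists>s. (s, q) \<in> P \<and> finite x"
      and unc: "\<And>q. (q, p) \<in> P \<Longrightarrow> \<not> fCountable P S q"
    for p\<^sub>0 p q :: 'a and S and l\<^sub>0 :: nat
  proof -
    define X where "X = {x. \<exists>s. (s, q) \<in> P \<and> fMem P S x s}"
    \<comment> \<open>Otherwise \<open>q\<close> would force \<open>S\<close> to be countable, by
      \<open>fCountableI\<close>.\<close>
    have "uncountable X"
      using fCountableI[OF po _ _, of q X S] unc[OF q] q X_def by (auto intro: FieldI1)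
    define c where "c x = (SOME s. (s, q) \<in> P \<and> fMem P S x s)" for x
    have c: "(c x, q) \<in> P" "fMem P S x (c x)" if "x \<in> X" for x
      using that someI_ex[of "\<lambda>s. (s, q) \<in> P \<and> fMem P S x s"] unfolding X_def c_def by auto
    have "finite x \<and> c x \<in> Field P" if "x \<in> X" for x
      using c[OF that] fin tr q by (meson FieldI1)
    then obtain D l where D: "l\<^sub>0 < l" "inj_on D {..<2}" "D ` {..<2} \<subseteq> X" "captured m n r \<F> 2 D l"
      "compat P (c (D 0)) (c (D (1 :: nat)))"
      using capture_cccD[OF cap \<open>uncountable X\<close>] by metis
    then obtain s where s: "(s, c (D 0)) \<in> P" "(s, c (D 1)) \<in> P"
      unfolding compat_def by blast
    have DX: "D 0 \<in> X" "D 1 \<in> X" using D(3) by auto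
    have mem: "fMem P S (D i) t" if "(t, s) \<in> P" "i < 2" for t i
    proof -
      have "i = 0 \<or> i = 1" using that(2) by linarith
      then show ?thesis
        using DX c s that(1) fMem_mono[OF trP] tr by metis
    qed
    have sq: "(s, q) \<in> P" using s(1) c(1)[OF DX(1)] tr by blast
    show ?thesis
    proof (intro exI[of _ l] exI[of _ s] conjI)
      show "fEx P (\<lambda>D. fAnd (fGround (inj_on D {..<2} \<and> captured m n r \<F> 2 D l))
        (fAll (\<lambda>i. fImp P (fGround (i < 2)) (fMem P S (D i))))) s"
        unfolding fAnd_def fAll_def
      proof (intro fExI[OF po, where x = D] conjI allI fImpI[OF po])
        fix t u and i :: nat assume "(t, s) \<in> P" "(u, t) \<in> P" "fGround (i < 2) u"
        then show "fMem P S (D i) u"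
          using mem tr unfolding fGround_def by blast
      qed (use D in \<open>auto simp: fGround_def\<close>)
    qed (use sq D in auto)
  qed
  note key = this
  show ?thesis
    unfolding forces_def fCapturing_def
  proof (intro ballI, subst fAll_def, intro allI fImpI[OF po], subst fAll_def, intro allI, goal_cases)
    case (1 p\<^sub>0 S p l\<^sub>0)
    then have fin: "\<exists>s. (s, q) \<in> P \<and> finite x" if "(q, p) \<in> P" "fMem P S x q" for x q
      using that by (auto simp: fAnd_def fAll_def fImp_iff fGround_def)
    have unc: "\<not> fCountable P S q" if "(q, p) \<in> P" for q
      using that 1 by (auto simp: fAnd_def fNot_def)
    show ?case
      unfolding fEx_iff[of _ _ p] using key[OF 1(2) _ fin unc] by (simp add: fAnd_def fGround_def)
  qed
qed


section \<open>Filters for omega_1 dense sets when m_F exceeds omega_1\<close>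

text \<open>Induction on the size, inserting one point of \<open>A\<close> at a time. This later
  bounds the number of finite antichains.\<close>

lemma card_of_finite_subsets:
  assumes B: "infinite B" and A: "|A| \<le>o |B|"
  shows "|{q. q \<subseteq> A \<and> finite q}| \<le>o |B|"
proof -
  define S where "S n = {q. q \<subseteq> A \<and> finite q \<and> card q = n}" for n
  have S: "|S n| \<le>o |B|" for n
  proof (induction n)
    case 0
    have "finite (S 0)"
      by (rule finite_subset[of _ "{{}}"]) (auto simp: S_def)
    then show ?case
      using finite_ordLess_infinite[OF card_of_Well_order card_of_Well_order] B
      by (auto simp: Field_card_of intro: ordLess_imp_ordLeq)
  next
    case (Suc n)
    have "S (Suc n) \<subseteq> (\<Union>t\<in>A. insert t ` S n)"
    proof
      fix q assume "q \<in> S (Suc n)"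
      then have "card q = Suc n" "q \<subseteq> A" by (simp_all add: S_def)
      then obtain t q' where "q = insert t q'" "t \<notin> q'" "card q' = n" "finite q'" "q \<subseteq> A"
        unfolding card_Suc_eq_finite by blast
      then show "q \<in> (\<Union>t\<in>A. insert t ` S n)"
        by (auto simp: S_def)
    qed
    moreover have "|\<Union>t\<in>A. insert t ` S n| \<le>o |B|"
    proof (rule card_of_UNION_ordLeq_infinite[OF B A], intro ballI)
      show "|insert t ` S n| \<le>o |B|" for t
        by (rule ordLeq_transitive[OF card_of_image Suc])
    qed
    ultimately show ?case
      by (rule ordLeq_transitive[OF card_of_mono1])
  qed
  have "{q. q \<subseteq> A \<and> finite q} = (\<Union>n. S n)"
    by (auto simp: S_def)
  moreover have "|UNIV :: nat set| \<le>o |B|"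
    using B infinite_iff_card_of_nat by blast
  ultimately show ?thesis
    using card_of_UNION_ordLeq_infinite[OF B _, of "UNIV :: nat set" S] S by auto
qed

lemma infinite_omega1: "infinite (UNIV :: omega1 set)"
  using uncountable_omega1 uncountable_infinite by blast

text \<open>Without such a filter, \<open>range E\<close> is an unmet family, so m(P) exists and is
  at most omega_1; but \<open>\<kappa>\<close> is at most m(P), since \<open>P\<close> is
  admissible.\<close>

lemma filter_of_m_scheme:
  fixes \<kappa> :: "'p set rel" and P :: "'p rel" and E :: "omega1 \<Rightarrow> 'p set"
  assumes cap: "capturing m n r \<F> 2" and \<kappa>: "is_m_scheme m n r \<F> \<kappa>" "cardSuc natLeq <o \<kappa>"
    and P: "forcing_notion P" "capture_ccc m n r \<F> P"
    and E: "\<And>a. dense_in P (E a)"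
  obtains G where "filter_in P G" "\<And>a. G \<inter> E a \<noteq> {}"
proof (rule ccontr)
  assume "\<not> thesis"
  then have "range E \<in> unmet_families P"
    using E that unfolding unmet_families_def by (simp add: image_iff) blast
  then obtain \<mu> where \<mu>: "\<mu> \<in> card_of ` unmet_families P" "\<And>D. D \<in> unmet_families P \<Longrightarrow> \<mu> \<le>o |D|"
    using exists_minim_Well_order[of "card_of ` unmet_families P"] card_of_Well_order
    by (smt (verit) empty_iff image_iff)
  then have "is_m_poset P \<mu>"
    unfolding is_m_poset_def using card_of_Card_order card_of_refl by auto
  moreover have "admissible m n r \<F> P"
    unfolding admissible_def using P capture_ccc_imp_ccc capture_ccc_imp_forces
    by (auto simp: forcing_notion_def)
  ultimately have "\<kappa> \<le>o \<mu>"
    using \<kappa>(1) cap unfolding is_m_scheme_def by auto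
  also have "\<mu> \<le>o |range E|" using \<mu>(2) \<open>range E \<in> _\<close> .
  also have "|range E| \<le>o |UNIV :: omega1 set|" by (rule card_of_image)
  also have "|UNIV :: omega1 set| =o cardSuc natLeq" by (rule card_omega1)
  finally show False
    using \<kappa>(2) not_ordLess_ordLeq by blast
qed

text \<open>The forcings behind \<open>\<kappa>\<close> have conditions in \<open>'p\<close>. As
  \<open>P\<close> has at most omega_1 conditions, it is copied into \<open>'p\<close>, and the
  filter for the copy is pulled back.\<close>

lemma filter_of_small_forcing:
  fixes \<kappa> :: "'p set rel" and P :: "'q rel" and E :: "omega1 \<Rightarrow> 'q set"
  assumes cap: "capturing m n r \<F> 2" and unc: "uncountable (UNIV :: 'p set)"
    and \<kappa>: "is_m_scheme m n r \<F> \<kappa>" "cardSuc natLeq <o \<kappa>"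
    and P: "forcing_notion P" "capture_ccc m n r \<F> P" "|Field P| \<le>o |UNIV :: omega1 set|"
    and E: "\<And>a. dense_in P (E a)"
  obtains G where "filter_in P G" "\<And>a. G \<inter> E a \<noteq> {}"
proof -
  have "|Field P| \<le>o |UNIV :: 'p set|"
    using P(3) uncountable_imp_omega1_ordLeq[OF unc] ordLeq_transitive by blast
  then obtain f :: "'q \<Rightarrow> 'p" where f: "inj_on f (Field P)"
    by (metis card_of_ordLeq)
  define P' where "P' = dir_image P f"
  have Field': "Field P' = f ` Field P" by (simp add: P'_def dir_image_Field)
  have P'_iff: "(f a, f b) \<in> P' \<longleftrightarrow> (a, b) \<in> P" if "a \<in> Field P" "b \<in> Field P" for a b
    using f that unfolding P'_def dir_image_def by (auto dest: inj_onD intro: FieldI1 FieldI2)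
  have fn: "forcing_notion P'"
    using P(1) f Field' Partial_order_dir_image[of P f] unfolding forcing_notion_def P'_def by simp
  have comp: "compat P' (f a) (f b)" if "compat P a b" for a b
    using that P'_iff unfolding compat_def by (meson FieldI1 FieldI2)
  have cc: "capture_ccc m n r \<F> P'"
    unfolding capture_ccc_def
  proof (intro allI impI, elim conjE)
    fix X and p :: "omega1 set \<Rightarrow> 'p" and l\<^sub>0 :: nat
    assume X: "uncountable X" "\<forall>x\<in>X. finite x \<and> p x \<in> Field P'"
    have fp: "f (inv_into (Field P) f (p x)) = p x" if "x \<in> X" for x
      using X(2) that Field' by (auto simp: f_inv_into_f)
    have "finite x \<and> inv_into (Field P) f (p x) \<in> Field P" if "x \<in> X" for x
      using X(2) that Field' by (auto intro: inv_into_into)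
    then obtain D l where D: "l\<^sub>0 < l" "inj_on D {..<2}" "D ` {..<2} \<subseteq> X" "captured m n r \<F> 2 D l"
      "compat P (inv_into (Field P) f (p (D 0))) (inv_into (Field P) f (p (D (1 :: nat))))"
      by (rule capture_cccD[OF P(2) X(1)])
    have "D 0 \<in> X" "D 1 \<in> X" using D(3) by auto
    then have "compat P' (p (D 0)) (p (D 1))" using comp[OF D(5)] fp by simp
    then show "\<exists>D l. l\<^sub>0 < l \<and> inj_on D {..<2} \<and> D ` {..<2} \<subseteq> X \<and>
      captured m n r \<F> 2 D l \<and> compat P' (p (D 0)) (p (D 1))"
      using D by blast
  qed
  have "dense_in P' (f ` E a)" for a
  proof -
    have "\<exists>t\<in>f ` E a. (t, f p) \<in> P'" if p: "p \<in> Field P" for p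
    proof -
      obtain q where "q \<in> E a" "(q, p) \<in> P" using E p unfolding dense_in_def by blast
      then show ?thesis using P'_iff[of q p] p FieldI1[of q p P] by blast
    qed
    then show ?thesis using E[of a] unfolding dense_in_def Field' by blast
  qed
  then obtain G' where G': "filter_in P' G'" "\<And>a. G' \<inter> f ` E a \<noteq> {}"
    using filter_of_m_scheme[OF cap \<kappa> fn cc, of "\<lambda>a. f ` E a"] by blast
  define G where "G = {q \<in> Field P. f q \<in> G'}"
  have "filter_in P G"
    unfolding filter_in_def
  proof (intro conjI ballI allI impI)
    show "G \<subseteq> Field P" by (auto simp: G_def)
    show "G \<noteq> {}" using G'(1) unfolding filter_in_def Field' G_def by blast
    show "q \<in> G" if "p \<in> G" "(p, q) \<in> P" for p q
      using that G'(1) P'_iff[of p q] unfolding filter_in_def G_def by (auto intro: FieldI2)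
    show "\<exists>s\<in>G. (s, p) \<in> P \<and> (s, q) \<in> P" if "p \<in> G" "q \<in> G" for p q
    proof -
      have "f p \<in> G'" "f q \<in> G'" using that by (auto simp: G_def)
      then obtain s' where s': "s' \<in> G'" "(s', f p) \<in> P'" "(s', f q) \<in> P'"
        using G'(1) unfolding filter_in_def by blast
      then obtain s where "s \<in> Field P" "s' = f s"
        using G'(1) unfolding filter_in_def Field' by blast
      then show ?thesis using s' that P'_iff unfolding G_def by blast
    qed
  qed
  moreover have "G \<inter> E a \<noteq> {}" for a
    using G'(2)[of a] E[of a] unfolding G_def dense_in_def by blast
  ultimately show thesis using that by blast
qed

text \<open>The sets \<open>B a\<close> need not be dense, hence the passage below some
  \<open>p\<close>. If every \<open>p\<close> had an extension \<open>e p\<close> with nothing of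
  \<open>B (c p)\<close> below it, a countable maximal family of incompatible conditions could still
  be prolonged.\<close>

lemma ccc_dense_below:
  fixes B :: "omega1 \<Rightarrow> 'q set"
  assumes po: "Partial_order P" and ccc: "ccc P"
    and ne: "\<And>a. B a \<inter> Field P \<noteq> {}"
    and anti: "\<And>a b. a \<le> b \<Longrightarrow> B b \<subseteq> B a"
    and opn: "\<And>a s q. q \<in> B a \<Longrightarrow> (s, q) \<in> P \<Longrightarrow> s \<in> B a"
  obtains p where "p \<in> Field P" "\<And>a q. (q, p) \<in> P \<Longrightarrow> \<exists>s\<in>B a. (s, q) \<in> P"
proof (rule ccontr)
  assume "\<not> thesis"
  then have "\<exists>q a. p \<in> Field P \<longrightarrow> (q, p) \<in> P \<and> (\<forall>s\<in>B a. (s, q) \<notin> P)" for p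
    using that[of p] by blast
  then obtain e c where ec: "\<And>p. p \<in> Field P \<Longrightarrow> (e p, p) \<in> P"
      "\<And>p s. p \<in> Field P \<Longrightarrow> s \<in> B (c p) \<Longrightarrow> (s, e p) \<notin> P"
    by metis
  have "\<exists>x. x \<in> B a \<and> x \<in> Field P" for a
    using ne[of a] by blast
  then obtain b where b: "\<And>a. b a \<in> B a" "\<And>a. b a \<in> Field P"
    by metis
  define q where "q a = e (b a)" for a
  have q: "q a \<in> B a" "q a \<in> Field P" for a
    using opn[OF b(1) ec(1)[OF b(2)]] FieldI1[OF ec(1)[OF b(2)]] unfolding q_def by auto
  let ?inc = "\<lambda>a a'. \<not> compat P (q a) (q a')"
  have "\<exists>M\<in>{K. pairwise ?inc K}. \<forall>X\<in>{K. pairwise ?inc K}. M \<subseteq> X \<longrightarrow> X = M"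
  proof (rule subset_Zorn')
    fix C assume "subset.chain {K. pairwise ?inc K} C"
    then have "chain\<^sub>\<subseteq> C" "C \<subseteq> {K. pairwise ?inc K}"
      by (auto simp: subset_chain_def chain_subset_def)
    then show "\<Union>C \<in> {K. pairwise ?inc K}"
      using pairwise_chain_Union[of C ?inc] by blast
  qed
  then obtain M where M: "pairwise ?inc M" "\<And>X. pairwise ?inc X \<Longrightarrow> M \<subseteq> X \<Longrightarrow> X = M"
    by blast
  have "compat P (q a) (q a)" for a
    using Partial_order_refl[OF po q(2)] unfolding compat_def by blast
  \<comment> \<open>Equal values are compatible, so distinct indices in \<open>M\<close> have
    distinct values, and ccc bounds the index set as well.\<close>
  then have "inj_on q M"
    using M(1) unfolding pairwise_def by (metis inj_onI)
  moreover have "pairwise (\<lambda>p q. \<not> compat P p q) (q ` M)"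
    using M(1) unfolding pairwise_def by (metis imageE)
  then have "countable (q ` M)"
    using ccc q(2) unfolding ccc_def by blast
  ultimately have "countable M"
    by (rule countable_image_inj_on[rotated])
  then have "countable (M \<union> (\<lambda>a. c (b a)) ` M)" by simp
  \<comment> \<open>A common extension of \<open>q x\<close> and \<open>q a\<close> would lie in
    \<open>B x\<close>, hence in \<open>B (c (b a))\<close>, and below \<open>e (b a)\<close>, which
    is impossible. So maximality puts \<open>x\<close> into \<open>M\<close>, although
    \<open>x\<close> exceeds all of \<open>M\<close>.\<close>
  then obtain x where x: "\<And>a. a \<in> M \<union> (\<lambda>a. c (b a)) ` M \<Longrightarrow> a < x"
    by (rule countable_bounded_omega1) blast
  have "\<not> compat P (q x) (q a)" if a: "a \<in> M" for a
  proof
    assume "compat P (q x) (q a)"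
    then obtain s where s: "(s, q x) \<in> P" "(s, q a) \<in> P" unfolding compat_def by blast
    have "s \<in> B x" using opn q(1) s(1) by blast
    then have "s \<in> B (c (b a))"
      using anti[of "c (b a)" x] x[of "c (b a)"] a less_imp_le[of "c (b a)" x] by auto
    then show False using ec(2)[OF b(2)] s(2) unfolding q_def by blast
  qed
  moreover have "compat P p q \<longleftrightarrow> compat P q p" for p q
    unfolding compat_def by blast
  ultimately have "pairwise ?inc (insert x M)"
    using M(1) unfolding pairwise_insert by blast
  then have "x \<in> M" using M(2) by blast
  then show False using x by blast
qed

text \<open>Below the \<open>p\<close> from \<open>ccc_dense_below\<close> the sets
  \<open>B a\<close> are dense, so a filter of the restricted order meets them all. Pairwise
  compatibility is what the tree arguments need from it.\<close>

lemma unbounded_linked_set: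
  fixes \<kappa> :: "'p set rel" and P :: "'q rel" and B :: "omega1 \<Rightarrow> 'q set"
  assumes cap: "capturing m n r \<F> 2" and unc: "uncountable (UNIV :: 'p set)"
    and \<kappa>: "is_m_scheme m n r \<F> \<kappa>" "cardSuc natLeq <o \<kappa>"
    and po: "Partial_order P" and cc: "capture_ccc m n r \<F> P"
    and small: "|Field P| \<le>o |UNIV :: omega1 set|"
    and ne: "\<And>a. B a \<inter> Field P \<noteq> {}"
    and anti: "\<And>a b. a \<le> b \<Longrightarrow> B b \<subseteq> B a"
    and opn: "\<And>a s q. q \<in> B a \<Longrightarrow> (s, q) \<in> P \<Longrightarrow> s \<in> B a"
  obtains G where "G \<subseteq> Field P" "\<And>p q. p \<in> G \<Longrightarrow> q \<in> G \<Longrightarrow> compat P p q" "\<And>a. G \<inter> B a \<noteq> {}"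
proof -
  obtain p where p: "p \<in> Field P" "\<And>a q. (q, p) \<in> P \<Longrightarrow> \<exists>s\<in>B a. (s, q) \<in> P"
  proof (rule ccc_dense_below[of P B])
    show "B a \<inter> Field P \<noteq> {}" for a by (rule ne)
    show "B b \<subseteq> B a" if "a \<le> b" for a b using that by (rule anti)
    show "s \<in> B a" if "q \<in> B a" "(s, q) \<in> P" for a s q using that by (rule opn)
  qed (use po capture_ccc_imp_ccc[OF cc] in auto)
  note refl = Partial_order_refl[OF po] and tr = Partial_order_trans[OF po]
  define P' where "P' = Restr P {q. (q, p) \<in> P}"
  have P'_iff: "(a, b) \<in> P' \<longleftrightarrow> (a, b) \<in> P \<and> (b, p) \<in> P" for a b
    using tr unfolding P'_def by blast
  have Field': "Field P' = {q. (q, p) \<in> P}"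
  proof (intro set_eqI iffI)
    fix q assume "q \<in> Field P'"
    then show "q \<in> {q. (q, p) \<in> P}" using tr P'_iff unfolding Field_def by blast
  next
    fix q assume "q \<in> {q. (q, p) \<in> P}"
    then have "(q, q) \<in> P'" using refl unfolding P'_iff by (simp add: FieldI1)
    then show "q \<in> Field P'" by (rule FieldI1)
  qed
  have "Partial_order P'"
    unfolding P'_def by (rule Partial_order_Restr[OF po])
  then have fn: "forcing_notion P'"
    using Field' refl[OF p(1)] unfolding forcing_notion_def by auto
  have "|Field P'| \<le>o |Field P|"
    by (rule card_of_mono1) (auto simp: Field' intro: FieldI1)
  then have small': "|Field P'| \<le>o |UNIV :: omega1 set|"
    using small ordLeq_transitive by blast
  have cc': "capture_ccc m n r \<F> P'"
    unfolding capture_ccc_def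
  proof (intro allI impI, elim conjE)
    fix X and f :: "omega1 set \<Rightarrow> 'q" and l\<^sub>0 :: nat
    assume X: "uncountable X" "\<forall>x\<in>X. finite x \<and> f x \<in> Field P'"
    then have "finite x \<and> f x \<in> Field P" if "x \<in> X" for x
      using that Field' by (auto intro: FieldI1)
    then obtain D l where D: "l\<^sub>0 < l" "inj_on D {..<2}" "D ` {..<2} \<subseteq> X" "captured m n r \<F> 2 D l"
      "compat P (f (D 0)) (f (D (1 :: nat)))"
      by (rule capture_cccD[OF cc X(1)])
    have "D 0 \<in> X" "D 1 \<in> X" using D(3) by auto
    then have "compat P' (f (D 0)) (f (D 1))"
      using D(5) X(2) Field' unfolding compat_def P'_iff by blast
    then show "\<exists>D l. l\<^sub>0 < l \<and> inj_on D {..<2} \<and> D ` {..<2} \<subseteq> X \<and>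
      captured m n r \<F> 2 D l \<and> compat P' (f (D 0)) (f (D 1))"
      using D by blast
  qed
  have "dense_in P' (B a \<inter> Field P')" for a
    using p(2) tr unfolding dense_in_def P'_iff Field' by blast
  then obtain G where G: "filter_in P' G" "\<And>a. G \<inter> (B a \<inter> Field P') \<noteq> {}"
    using filter_of_small_forcing[OF cap unc \<kappa> fn cc' small', of "\<lambda>a. B a \<inter> Field P'"] by blast
  show thesis
  proof (rule that)
    show "G \<subseteq> Field P"
      using G(1) unfolding filter_in_def Field' by (auto intro: FieldI1)
    show "compat P p q" if "p \<in> G" "q \<in> G" for p q
      using that G(1) unfolding filter_in_def compat_def P'_iff by blast
    show "G \<inter> B a \<noteq> {}" for a using G(2)[of a] by blast
  qed
qed


section \<open>Suslin trees\<close>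

locale suslin =
  fixes T :: "'t rel"
  assumes suslin: "suslin_tree T"
begin

lemma po: "Partial_order T"
  and wo_underS: "t \<in> Field T \<Longrightarrow> well_order_on (underS T t) (Restr T (underS T t))"
  and countable_chain: "C \<in> Chains T \<Longrightarrow> countable C"
  and countable_antichain: "A \<subseteq> Field T \<Longrightarrow> pairwise (\<lambda>s t. (s, t) \<notin> T) A \<Longrightarrow> countable A"
  using suslin unfolding suslin_tree_def is_tree_def by blast+

lemmas refl = Partial_order_refl[OF po]
lemmas tr = Partial_order_trans[OF po]

lemma anti: "(a, b) \<in> T \<Longrightarrow> (b, a) \<in> T \<Longrightarrow> a = b"
  using po unfolding partial_order_on_def by (auto dest: antisymD)

lemma below_comparable:
  assumes "(a, t) \<in> T" "(b, t) \<in> T"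
  shows "(a, b) \<in> T \<or> (b, a) \<in> T"
proof (cases "a = t \<or> b = t \<or> a = b")
  case True
  then show ?thesis using assms refl by (meson FieldI1)
next
  case False
  then have ab: "a \<in> underS T t" "b \<in> underS T t"
    using assms by (auto simp: underS_def)
  have "total_on (underS T t) (Restr T (underS T t))"
    using wo_underS[of t] assms(1) unfolding well_order_on_def linear_order_on_def
    by (meson FieldI2)
  then have "(a, b) \<in> Restr T (underS T t) \<or> (b, a) \<in> Restr T (underS T t)"
    using ab False unfolding total_on_def by blast
  then show ?thesis by blast
qed

text \<open>If \<open>Z\<close> contains predecessors of \<open>z\<close>, the well-order on
  \<open>underS T z\<close> gives a least one, minimal in \<open>Z\<close> by transitivity;
  otherwise \<open>z\<close> is minimal.\<close>

lemma wf: "wf (T - Id)"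
proof (rule wfI_min)
  fix z and Z :: "'t set"
  assume z: "z \<in> Z"
  show "\<exists>w\<in>Z. \<forall>y. (y, w) \<in> T - Id \<longrightarrow> y \<notin> Z"
  proof (cases "underS T z \<inter> Z = {}")
    case True
    then show ?thesis using z by (auto simp: underS_def)
  next
    case False
    then obtain x where x: "x \<in> underS T z \<inter> Z" by blast
    then have "z \<in> Field T" by (auto simp: underS_def intro: FieldI2)
    then have "wf (Restr T (underS T z) - Id)"
      using wo_underS unfolding well_order_on_def by blast
    then obtain w where w: "w \<in> underS T z \<inter> Z"
      "\<And>y. (y, w) \<in> Restr T (underS T z) - Id \<Longrightarrow> y \<notin> underS T z \<inter> Z"
      using x by (rule wfE_min) blast
    have "y \<notin> Z" if y: "(y, w) \<in> T - Id" for y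
    proof
      assume "y \<in> Z"
      have "(w, z) \<in> T" "w \<noteq> z" using w(1) by (auto simp: underS_def)
      then have "y \<in> underS T z"
        using y tr[of y w z] anti[of w z] by (auto simp: underS_def)
      then show False using w y \<open>y \<in> Z\<close> by blast
    qed
    then show ?thesis using w(1) by blast
  qed
qed

section \<open>Heights and levels of the tree\<close>

text \<open>Heights are elements of \<open>omega1\<close> rather than order types up to isomorphism,
  so that they can enter the finite sets to be captured.\<close>

definition ht :: "'t \<Rightarrow> omega1" where
  "ht = wfrec (T - Id) (\<lambda>h t. LEAST a. \<forall>s\<in>underS T t. h s < a)"

lemma ht_eq: "ht t = (LEAST a. \<forall>s\<in>underS T t. ht s < a)"
proof -
  have "cut ht (T - Id) t s = ht s" if "s \<in> underS T t" for s
    using that by (auto simp: cut_apply underS_def)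
  then have "(\<forall>s\<in>underS T t. cut ht (T - Id) t s < a) \<longleftrightarrow> (\<forall>s\<in>underS T t. ht s < a)" for a
    by simp
  moreover have "ht t = (LEAST a. \<forall>s\<in>underS T t. cut ht (T - Id) t s < a)"
    unfolding ht_def by (subst wfrec[OF wf]) (rule HOL.refl)
  ultimately show ?thesis by simp
qed

text \<open>The predecessors of \<open>t\<close> form a chain, which is countable; so their heights
  are bounded in \<open>omega1\<close>, and the \<open>LEAST\<close> in \<open>ht_eq\<close> is
  attained.\<close>

lemma ht_less: "s \<in> underS T t \<Longrightarrow> ht s < ht t"
proof -
  have "underS T t \<in> Chains T"
    unfolding Chains_def using below_comparable by (auto simp: underS_def)
  then have "countable (ht ` underS T t)"
    using countable_chain by blast
  then obtain b where "\<And>a. a \<in> ht ` underS T t \<Longrightarrow> a < b"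
    by (rule countable_bounded_omega1) blast
  then have "\<forall>s\<in>underS T t. ht s < b" by blast
  then have "\<forall>s\<in>underS T t. ht s < ht t"
    unfolding ht_eq[of t] by (rule LeastI)
  then show "s \<in> underS T t \<Longrightarrow> ht s < ht t" by blast
qed

lemma ht_mono: "(s, t) \<in> T \<Longrightarrow> ht s \<le> ht t"
  using ht_less[of s t] by (cases "s = t") (auto simp: underS_def less_imp_le)

lemma ht_le_of_underS: "underS T s \<subseteq> underS T t \<Longrightarrow> ht s \<le> ht t"
  using ht_less[of _ t] by (subst ht_eq) (auto intro: Least_le)

definition ht_level :: "omega1 \<Rightarrow> 't set" where
  "ht_level a = {t \<in> Field T. ht t = a}"

lemma countable_ht_level: "countable (ht_level a)"
proof (rule countable_antichain)
  show "pairwise (\<lambda>s t. (s, t) \<notin> T) (ht_level a)"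
  proof (rule pairwiseI)
    fix s t assume "s \<in> ht_level a" "t \<in> ht_level a" "s \<noteq> t"
    then show "(s, t) \<notin> T"
      using ht_less[of s t] by (auto simp: ht_level_def underS_def)
  qed
qed (auto simp: ht_level_def)

text \<open>Height and this number together determine a node; the number, from a countable type, can
  be fixed on an uncountable family.\<close>

definition num :: "'t \<Rightarrow> nat" where
  "num t = to_nat_on (ht_level (ht t)) t"

lemma num_inj:
  assumes "t \<in> Field T" "u \<in> Field T" "ht t = ht u" "num t = num u"
  shows "t = u"
  using assms inj_on_to_nat_on[OF countable_ht_level[of "ht t"]]
  by (auto simp: num_def ht_level_def dest: inj_onD)

text \<open>One node is chosen at each level below omega_1. These nodes differ because distinct
  proper initial segments of a well-order are not isomorphic.\<close>

lemma uncountable_Field: "uncountable (Field T)"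
proof
  let ?W = "cardSuc natLeq :: nat set rel"
  have W: "Well_order ?W" by (rule cardSuc_natLeq_Well_order)
  have FW: "uncountable (Field ?W)"
    using uncountable_omega1 type_definition.Rep_range[OF type_definition_omega1]
    by (metis Rep_omega1_inject countable_image_inj_on inj_onI)
  then have NE: "Field ?W \<noteq> {}" by auto
  define al where "al x = Restr ?W (underS ?W x)" for x
  have "\<exists>t. t \<in> Field T \<and> Restr T (underS T t) =o al x" for x
  proof -
    have "al x <o ?W"
      unfolding al_def by (rule underS_Restr_ordLess[OF W NE])
    then have "tree_level T (al x) \<noteq> {}"
      using suslin unfolding suslin_tree_def tree_height_def by blast
    then show ?thesis unfolding tree_level_def by blast
  qed
  then obtain f where f: "\<And>x. f x \<in> Field T" "\<And>x. Restr T (underS T (f x)) =o al x"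
    by metis
  have less: "al x <o al y" if "(x, y) \<in> ?W" "x \<noteq> y" for x y
  proof -
    have wo: "wo_rel ?W" using W by (simp add: wo_rel_def)
    have "underS ?W x \<subset> underS ?W y"
      using underS_incr[OF wo_rel.TRANS[OF wo] wo_rel.ANTISYM[OF wo] that(1)] that
      by (auto simp: underS_def)
    then show ?thesis
      unfolding al_def
      using ofilter_subset_ordLess[OF W wo_rel.underS_ofilter[OF wo] wo_rel.underS_ofilter[OF wo]]
      by blast
  qed
  have "inj_on f (Field ?W)"
  proof (rule inj_onI, rule ccontr)
    fix x y assume xy: "x \<in> Field ?W" "y \<in> Field ?W" "f x = f y" "x \<noteq> y"
    have iso: "al x =o al y"
      using f(2)[of x] f(2)[of y] xy(3) ordIso_symmetric ordIso_transitive by metis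
    have "Total ?W"
      using W unfolding well_order_on_def linear_order_on_def by blast
    then have "(x, y) \<in> ?W \<or> (y, x) \<in> ?W"
      using xy unfolding total_on_def by blast
    then show False
      using less[of x y] less[of y x] xy(4) iso not_ordLess_ordIso ordIso_symmetric by blast
  qed
  moreover assume "countable (Field T)"
  then have "countable (f ` Field ?W)"
    using f(1) by (meson countable_subset image_subsetI)
  ultimately show False
    using FW countable_image_inj_on by blast
qed

lemma Field_eq: "Field T = (\<Union>a. ht_level a)"
  by (auto simp: ht_level_def)

lemma card_Field: "|Field T| \<le>o |UNIV :: omega1 set|"
  unfolding Field_eq
proof (rule card_of_UNION_ordLeq_infinite[OF infinite_omega1], rule card_of_mono1, simp, intro ballI)
  fix a
  have "|ht_level a| \<le>o natLeq"
    using countable_ht_level[of a] by (simp add: countable_card_le_natLeq)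
  moreover have "natLeq \<le>o |UNIV :: omega1 set|"
    using infinite_omega1 infinite_iff_natLeq_ordLeq by blast
  ultimately show "|ht_level a| \<le>o |UNIV :: omega1 set|"
    by (rule ordLeq_transitive)
qed

text \<open>If all heights were below \<open>a\<close>, then \<open>A\<close> would lie in countably
  many countable levels.\<close>

lemma ht_unbounded:
  assumes "A \<subseteq> Field T" "uncountable A"
  obtains t where "t \<in> A" "a \<le> ht t"
proof (rule ccontr)
  assume "\<not> thesis"
  then have "ht t < a" if "t \<in> A" for t
    using that \<open>\<And>t. t \<in> A \<Longrightarrow> a \<le> ht t \<Longrightarrow> thesis\<close> by (meson not_le)
  then have "A \<subseteq> (\<Union>b\<in>{..<a}. ht_level b)"
    using assms(1) by (auto simp: ht_level_def)
  moreover have "countable (\<Union>b\<in>{..<a}. ht_level b)"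
    using countable_below_omega1 countable_ht_level by blast
  ultimately show False
    using assms(2) countable_subset by blast
qed

section \<open>Compatibility and branching of nodes\<close>

lemma compat_converse_iff:
  assumes "s \<in> Field T" "t \<in> Field T"
  shows "compat (T\<inverse>) s t \<longleftrightarrow> (s, t) \<in> T \<or> (t, s) \<in> T"
  using assms below_comparable refl unfolding compat_def by blast

text \<open>A node of least height below \<open>t\<close> but not below \<open>t'\<close>; unspecified if \<open>t\<close> lies below \<open>t'\<close>.\<close>

definition br :: "'t \<Rightarrow> 't \<Rightarrow> 't" where
  "br t t' = (SOME u. (u, t) \<in> T \<and> (u, t') \<notin> T \<and> (\<forall>v\<in>underS T u. (v, t') \<in> T))"

lemma br:
  assumes "t \<in> Field T" "(t, t') \<notin> T"
  shows "(br t t', t) \<in> T" "(br t t', t') \<notin> T" "v \<in> underS T (br t t') \<Longrightarrow> (v, t') \<in> T"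
proof -
  have "t \<in> {u. (u, t) \<in> T \<and> (u, t') \<notin> T}"
    using assms refl by blast
  with wf obtain u where u: "u \<in> {u. (u, t) \<in> T \<and> (u, t') \<notin> T}"
    "\<And>v. (v, u) \<in> T - Id \<Longrightarrow> v \<notin> {u. (u, t) \<in> T \<and> (u, t') \<notin> T}"
    by (rule wfE_min) blast
  have "(v, t') \<in> T" if "v \<in> underS T u" for v
    using that u tr[of v u t] by (auto simp: underS_def)
  then have "\<exists>u. (u, t) \<in> T \<and> (u, t') \<notin> T \<and> (\<forall>v\<in>underS T u. (v, t') \<in> T)"
    using u(1) by blast
  from someI_ex[OF this]
  show "(br t t', t) \<in> T" "(br t t', t') \<notin> T" "v \<in> underS T (br t t') \<Longrightarrow> (v, t') \<in> T"
    unfolding br_def by blast+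
qed

text \<open>Let \<open>w\<close> be the common branching node. If \<open>t\<close> is below
  \<open>u'\<close>, so is \<open>w\<close>. If \<open>u'\<close> is below \<open>t\<close>, it is
  comparable with \<open>w\<close>, so \<open>w\<close> is below \<open>u'\<close> or
  \<open>u'\<close> is below \<open>u\<close>. All of this is excluded.\<close>

lemma incomparable_if_br_eq:
  assumes "t \<in> Field T" "u \<in> Field T" "(t, t') \<notin> T" "(u, u') \<notin> T" "(u', u) \<notin> T"
    and eq: "br t t' = br u u'"
  shows "(t, u') \<notin> T \<and> (u', t) \<notin> T"
proof -
  note b = br(1,2)[OF assms(1,3)] br(1,2)[OF assms(2,4)]
  have "(t, u') \<notin> T" using b tr eq by metis
  moreover have "(u', t) \<notin> T"
    using b below_comparable[of "br t t'" t u'] tr[of u' "br t t'" u] eq assms(5) by auto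
  ultimately show ?thesis by blast
qed

text \<open>Everything strictly below \<open>br u u'\<close> is strictly below \<open>u'\<close>, so
  \<open>u'\<close> is at least as high and not below \<open>t\<close>. If \<open>t\<close> were
  below \<open>u'\<close>, then, not being below \<open>u\<close>, it would lie above all
  predecessors of \<open>br u u'\<close> and reach its height.\<close>

lemma incomparable_if_ht_less_br:
  assumes "u \<in> Field T" "(t, u) \<notin> T" "(u, u') \<notin> T" "(u', u) \<notin> T"
    and ht: "ht t < ht (br u u')"
  shows "(t, u') \<notin> T \<and> (u', t) \<notin> T"
proof -
  let ?w = "br u u'"
  note w = br[OF assms(1,3)]
  have "underS T ?w \<subseteq> underS T u'"
    using w(1,3) tr[of u' ?w u] assms(4) by (auto simp: underS_def)
  then have "ht ?w \<le> ht u'" by (rule ht_le_of_underS)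
  then have "(u', t) \<notin> T"
    using ht ht_mono[of u' t] by auto
  moreover have "(t, u') \<notin> T"
  proof
    assume t: "(t, u') \<in> T"
    have "v \<in> underS T t" if v: "v \<in> underS T ?w" for v
    proof -
      have "(t, v) \<notin> T"
        using v tr[of t v ?w] tr[of t ?w u] w(1) assms(2) by (auto simp: underS_def)
      moreover have "(v, t) \<in> T \<or> (t, v) \<in> T"
        using below_comparable[OF w(3)[OF v] t] .
      moreover have "v \<noteq> t"
        using calculation refl t by (meson FieldI1)
      ultimately show ?thesis by (simp add: underS_def)
    qed
    then have "ht ?w \<le> ht t" by (intro ht_le_of_underS subsetI)
    then show False using ht by simp
  qed
  ultimately show ?thesis by blast
qed


section \<open>Forcing with finite antichains\<close>

definition antichains :: "'t set \<Rightarrow> 't set set" where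
  "antichains A = {q. finite q \<and> q \<subseteq> A \<and> pairwise (\<lambda>s t. (s, t) \<notin> T) q}"

definition antichain_forcing :: "'t set \<Rightarrow> 't set rel" where
  "antichain_forcing A = {(q, p). q \<in> antichains A \<and> p \<in> antichains A \<and> p \<subseteq> q}"

lemma Field_antichain_forcing: "Field (antichain_forcing A) = antichains A"
  by (auto simp: Field_def antichain_forcing_def)

lemma Partial_order_antichain_forcing: "Partial_order (antichain_forcing A)"
  unfolding partial_order_on_def preorder_on_def refl_on_def Field_antichain_forcing
  by (auto simp: antichain_forcing_def trans_def antisym_def)

lemma capture_ccc_antichain_forcing:
  assumes cap: "capturing m n r \<F> 2"
    and A: "A \<subseteq> Field T"
    and s: "inj_on s A" "\<And>t. t \<in> A \<Longrightarrow> finite (s t)"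
    and obstr: "\<And>l t u. l\<^sub>0 < l \<Longrightarrow> t \<in> A \<Longrightarrow> u \<in> A \<Longrightarrow> t \<noteq> u \<Longrightarrow>
      captured m n r \<F> 2 (\<lambda>i :: nat. if i = 0 then s t else s u) l \<Longrightarrow> (t, u) \<notin> T \<and> (u, t) \<notin> T"
  shows "capture_ccc m n r \<F> (antichain_forcing A)"
  unfolding capture_ccc_def Field_antichain_forcing
proof (intro allI impI, elim conjE)
  fix X and p :: "omega1 set \<Rightarrow> 't set" and l\<^sub>1 :: nat
  assume X: "uncountable X" "\<forall>x\<in>X. finite x \<and> p x \<in> antichains A"
  have fin: "finite x" "finite (p x)" "p x \<subseteq> A" if "x \<in> X" for x
    using X(2) that unfolding antichains_def by blast+
  have anti_p: "(t, u) \<notin> T" if "x \<in> X" "t \<in> p x" "u \<in> p x" "t \<noteq> u" for x t u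
    using X(2) that unfolding antichains_def pairwise_def by blast
  have "\<exists>ts. set ts = p x \<and> distinct ts" if "x \<in> X" for x
    using fin(2)[OF that] by (rule finite_distinct_list)
  then obtain ts where ts: "\<And>x. x \<in> X \<Longrightarrow> set (ts x) = p x" "\<And>x. x \<in> X \<Longrightarrow> distinct (ts x)"
    by metis
  \<comment> \<open>The part \<open>x\<close> returns the capture to \<open>X\<close>, the sets
    \<open>s t\<close> serve \<open>obstr\<close>, and the heights serve \<open>cross\<close>. For
    \<open>t = u\<close> the node \<open>br t u\<close> is unspecified; \<open>cross\<close> uses
    distinct indices only.\<close>
  define E where "E x = x \<union> (\<Union>t\<in>p x. s t) \<union> ht ` p x \<union> (\<lambda>(t, u). ht (br t u)) ` (p x \<times> p x)" for x
  have fin_E: "finite (E x)" if "x \<in> X" for x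
    using fin[OF that] s(2) unfolding E_def by auto
  \<comment> \<open>Positions are read along the enumeration \<open>ts x\<close>; the second entry
    also fixes the length of \<open>ts x\<close>.\<close>
  define ty where "ty x = (positions (E x) x, map (\<lambda>t. positions (E x) (s t)) (ts x),
      map (\<lambda>t. map (\<lambda>u. (positions (E x) {ht (br t u)}, num (br t u))) (ts x)) (ts x))" for x
  obtain v where v: "uncountable {x \<in> X. ty x = v}"
    using uncountable_fibre[OF X(1)] .
  define Y where "Y = {x \<in> X. ty x = v}"
  have YX: "x \<in> X" if "x \<in> Y" for x using that by (simp add: Y_def)
  \<comment> \<open>\<open>E\<close> may identify members of \<open>Y\<close>, but a finite set
    \<open>E x\<close> has only finitely many subsets, hence finitely many preimages.\<close>
  have "uncountable (E ` Y)"
  proof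
    assume *: "countable (E ` Y)"
    have "Y \<subseteq> (\<Union>e\<in>E ` Y. Pow e)"
      by (auto simp: E_def)
    moreover have "countable (\<Union>e\<in>E ` Y. Pow e)"
      by (rule countable_UN[OF *]) (use fin_E YX in \<open>auto intro!: countable_finite\<close>)
    ultimately have "countable Y" by (rule countable_subset)
    then show False using v by (simp add: Y_def)
  qed
  moreover have "\<forall>e\<in>E ` Y. finite e" using fin_E YX by simp
  ultimately have "infinite {l. \<exists>D. inj_on D {..<2} \<and> D ` {..<2} \<subseteq> E ` Y \<and> captured m n r \<F> 2 D l}"
    using cap[unfolded capturing_def, rule_format, of "E ` Y"] by simp
  \<comment> \<open>The level must exceed \<open>l\<^sub>0\<close> for \<open>obstr\<close> and
    \<open>l\<^sub>1\<close> for the claim.\<close>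
  then have "\<exists>l > max l\<^sub>0 l\<^sub>1. l \<in> {l. \<exists>D. inj_on D {..<2} \<and> D ` {..<2} \<subseteq> E ` Y \<and> captured m n r \<F> 2 D l}"
    unfolding infinite_nat_iff_unbounded by (rule spec)
  then obtain l D where l: "max l\<^sub>0 l\<^sub>1 < l" and D: "inj_on D {..<2 :: nat}" "D ` {..<2} \<subseteq> E ` Y"
    "captured m n r \<F> 2 D l"
    by (elim exE conjE CollectE) (rule that)
  have "D 0 \<in> E ` Y" "D 1 \<in> E ` Y" using D(2) by auto
  then obtain x y where xy: "x \<in> Y" "y \<in> Y" "D 0 = E x" "D 1 = E y" by blast
  note xX = YX[OF xy(1)] and yX = YX[OF xy(2)]
  have "D 0 \<noteq> D 1" using D(1) by (auto dest: inj_onD)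
  then have "x \<noteq> y" using xy by auto
  have ty: "ty x = ty y" using xy by (simp add: Y_def)
  have sub: "captured m n r \<F> 2 (\<lambda>i :: nat. if i = 0 then a else b) l"
    if "a \<subseteq> E x" "b \<subseteq> E y" "positions (E x) a = positions (E y) b" for a b
  proof (rule captured_sub[OF D(3)])
    fix i :: nat assume "i < 2"
    then have "i = 0 \<or> i = 1" by linarith
    then show "(if i = 0 then a else b) \<subseteq> D i" "positions (D i) (if i = 0 then a else b) = positions (E y) b"
      using that xy by auto
  qed simp
  have cap_xy: "captured m n r \<F> 2 (\<lambda>i :: nat. if i = 0 then x else y) l"
    using ty by (intro sub) (auto simp: E_def ty_def)
  from D(3) obtain R where R: "delta_system 2 D R"
    unfolding captured_def by (elim exE conjE) (rule that)
  then have RE: "R \<subseteq> E x" "R \<subseteq> E y" "set_less R (E x - R)" "set_less R (E y - R)"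
    "set_less (E x - R) (E y - R)"
    unfolding delta_system_def xy(3,4)[symmetric] by simp_all
  define k where "k = length (ts x)"
  have k: "length (ts y) = k"
  proof -
    have "map (\<lambda>t. positions (E x) (s t)) (ts x) = map (\<lambda>t. positions (E y) (s t)) (ts y)"
      using ty by (simp add: ty_def)
    from arg_cong[OF this, of length] show ?thesis by (simp add: k_def)
  qed
  have ty2: "positions (E x) (s (ts x ! i)) = positions (E y) (s (ts y ! i))" if "i < k" for i
  proof -
    have "map (\<lambda>t. positions (E x) (s t)) (ts x) ! i = map (\<lambda>t. positions (E y) (s t)) (ts y) ! i"
      using ty by (simp add: ty_def)
    then show ?thesis using that k by (simp add: k_def)
  qed
  have ty3: "positions (E x) {ht (br (ts x ! i) (ts x ! j))} = positions (E y) {ht (br (ts y ! i) (ts y ! j))}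
      \<and> num (br (ts x ! i) (ts x ! j)) = num (br (ts y ! i) (ts y ! j))" if "i < k" "j < k" for i j
  proof -
    have "map (\<lambda>t. map (\<lambda>u. (positions (E x) {ht (br t u)}, num (br t u))) (ts x)) (ts x) ! i ! j =
        map (\<lambda>t. map (\<lambda>u. (positions (E y) {ht (br t u)}, num (br t u))) (ts y)) (ts y) ! i ! j"
      using ty by (simp add: ty_def)
    then show ?thesis using that k by (simp add: k_def)
  qed
  have px: "t \<in> p x \<longleftrightarrow> (\<exists>i<k. t = ts x ! i)" for t
    unfolding ts(1)[OF xX, symmetric] in_set_conv_nth k_def by auto
  have py: "t \<in> p y \<longleftrightarrow> (\<exists>i<k. t = ts y ! i)" for t
    unfolding ts(1)[OF yX, symmetric] in_set_conv_nth k by auto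
  have diag: "ts x ! i = ts y ! i \<or> (ts x ! i, ts y ! i) \<notin> T \<and> (ts y ! i, ts x ! i) \<notin> T"
    if i: "i < k" for i
  proof -
    have ip: "ts x ! i \<in> p x" "ts y ! i \<in> p y" using px py i by blast+
    then have "captured m n r \<F> 2 (\<lambda>j :: nat. if j = 0 then s (ts x ! i) else s (ts y ! i)) l"
      using ty2[OF i] by (intro sub) (auto simp: E_def)
    then show ?thesis
      using obstr[of l "ts x ! i" "ts y ! i"] l ip fin(3)[OF xX] fin(3)[OF yX] by auto
  qed
  have cross: "(ts x ! i, ts y ! j) \<notin> T \<and> (ts y ! j, ts x ! i) \<notin> T"
    if ij: "i < k" "j < k" "i \<noteq> j" for i j
  proof -
    let ?t = "ts x ! i" and ?t' = "ts x ! j" and ?u = "ts y ! i" and ?u' = "ts y ! j"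
    have mem: "?t \<in> p x" "?t' \<in> p x" "?u \<in> p y" "?u' \<in> p y" using px py ij by blast+
    then have Field: "?t \<in> Field T" "?t' \<in> Field T" "?u \<in> Field T" "?u' \<in> Field T"
      using fin(3)[OF xX] fin(3)[OF yX] A by blast+
    have "?t \<noteq> ?t'" "?u \<noteq> ?u'"
      using ts(2)[OF xX] ts(2)[OF yX] ij k k_def by (simp_all add: nth_eq_iff_index_eq)
    then have inc: "(?t, ?t') \<notin> T" "(?u, ?u') \<notin> T" "(?u', ?u) \<notin> T"
      using anti_p[OF xX mem(1,2)] anti_p[OF yX mem(3,4)] anti_p[OF yX mem(4,3)] by auto
    let ?w = "br ?t ?t'" and ?z = "br ?u ?u'"
    have E: "ht ?w \<in> E x" "ht ?z \<in> E y" "ht ?t \<in> E x"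
      using mem unfolding E_def by (auto simp: image_iff)
    note pos = ty3[OF ij(1,2)]
    show ?thesis
    proof (cases "ht ?z \<in> R")
      \<comment> \<open>In the root the branching heights agree, and equal \<open>num\<close> then
        makes the branching nodes themselves equal.\<close>
      case True
      then have "ht ?w = ht ?z"
        using positions_root[OF fin_E[OF xX] RE(1,3) E(1) fin_E[OF yX] RE(2,4) E(2)] pos by blast
      then have "?w = ?z"
        using num_inj pos br(1)[OF Field(1) inc(1)] br(1)[OF Field(3) inc(2)] by (meson FieldI1)
      then show ?thesis
        by (rule incomparable_if_br_eq[OF Field(1,3) inc])
    next
      case False
      \<comment> \<open>\<open>E x\<close> is the first set of the captured pair, so each of its
        elements, in the root or in the tail, lies below the tail of \<open>E y\<close>.\<close>
      then have less: "ht ?t < ht ?z"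
        using E(2,3) RE(4,5) unfolding set_less_def by blast
      moreover have "(?t, ?u) \<notin> T"
      proof
        assume "(?t, ?u) \<in> T"
        then have "?t = ?u" using diag[OF ij(1)] by blast
        then show False
          using ht_mono[OF br(1)[OF Field(3) inc(2)]] less by simp
      qed
      ultimately show ?thesis
        using incomparable_if_ht_less_br[OF Field(3) _ inc(2,3)] by blast
    qed
  qed
  have "(t, u) \<notin> T \<and> (u, t) \<notin> T" if tu: "t \<in> p x" "u \<in> p y" "t \<noteq> u" for t u
  proof -
    obtain i j where "i < k" "t = ts x ! i" "j < k" "u = ts y ! j"
      using px py tu by blast
    then show ?thesis using diag[of i] cross[of i j] tu(3) by (cases "i = j") auto
  qed
  then have "p x \<union> p y \<in> antichains A"
    using fin[OF xX] fin[OF yX] anti_p[OF xX] anti_p[OF yX]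
    unfolding antichains_def pairwise_def by (simp add: ball_Un)
  then have "compat (antichain_forcing A) (p x) (p y)"
    using X(2) xX yX unfolding compat_def antichain_forcing_def by blast
  then show "\<exists>D l. l\<^sub>1 < l \<and> inj_on D {..<2} \<and> D ` {..<2} \<subseteq> X \<and> captured m n r \<F> 2 D l \<and>
      compat (antichain_forcing A) (p (D 0)) (p (D (1 :: nat)))"
    using l cap_xy \<open>x \<noteq> y\<close> xX yX
    by (intro exI[of _ "\<lambda>i :: nat. if i = 0 then x else y"] exI[of _ l]) (auto simp: inj_on_def)
qed

text \<open>A counterexample to capture-ccc attaches nodes to finite sets. Inverting this map on an
  uncountable set where it is injective attaches finite sets to nodes.\<close>

lemma capture_obstruction:
  assumes cap: "capturing m n r \<F> 2" and ncc: "\<not> capture_ccc m n r \<F> (T\<inverse>)"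
  obtains A s l\<^sub>0 where "A \<subseteq> Field T" "uncountable A" "inj_on s A" "\<And>t. t \<in> A \<Longrightarrow> finite (s t)"
    "\<And>l t u. l\<^sub>0 < l \<Longrightarrow> t \<in> A \<Longrightarrow> u \<in> A \<Longrightarrow> t \<noteq> u \<Longrightarrow>
      captured m n r \<F> 2 (\<lambda>i :: nat. if i = 0 then s t else s u) l \<Longrightarrow> (t, u) \<notin> T \<and> (u, t) \<notin> T"
proof -
  from ncc obtain X p l\<^sub>0 where X: "uncountable X" "\<forall>x\<in>X. finite x \<and> p x \<in> Field (T\<inverse>)"
    and no: "\<not> (\<exists>D l. l\<^sub>0 < l \<and> inj_on D {..<2} \<and> D ` {..<2} \<subseteq> X \<and> captured m n r \<F> 2 D l \<and>
      compat (T\<inverse>) (p (D 0)) (p (D (1 :: nat))))"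
    unfolding capture_ccc_def not_all not_imp by (elim exE conjE) (rule that)
  have Xf: "finite x" "p x \<in> Field T" if "x \<in> X" for x
    using X(2) that by auto
  have inc: "(p (D 0), p (D 1)) \<notin> T \<and> (p (D 1), p (D 0)) \<notin> T"
    if "l\<^sub>0 < l" "inj_on D {..<2 :: nat}" "D ` {..<2} \<subseteq> X" "captured m n r \<F> 2 D l" for D l
  proof -
    have "D 0 \<in> X" "D 1 \<in> X" using that(3) by auto
    then show ?thesis
      using no that compat_converse_iff Xf(2) by blast
  qed
  \<comment> \<open>On an uncountable fibre of \<open>p\<close>, 2-capturing would give a captured
    pair with one and the same node, which is comparable with itself.\<close>
  have "uncountable (p ` X)"
  proof
    assume "countable (p ` X)"
    moreover have "X = (\<Union>t\<in>p ` X. {x \<in> X. p x = t})" by blast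
    ultimately obtain t where t: "uncountable {x \<in> X. p x = t}"
      using X(1) countable_UN[of "p ` X" "\<lambda>t. {x \<in> X. p x = t}"] by metis
    let ?Y = "{x \<in> X. p x = t}"
    have "infinite {l. \<exists>D. inj_on D {..<2} \<and> D ` {..<2} \<subseteq> ?Y \<and> captured m n r \<F> 2 D l}"
      using cap[unfolded capturing_def, rule_format, of ?Y] t Xf(1) by simp
    then have "\<exists>l > l\<^sub>0. l \<in> {l. \<exists>D. inj_on D {..<2} \<and> D ` {..<2} \<subseteq> ?Y \<and> captured m n r \<F> 2 D l}"
      unfolding infinite_nat_iff_unbounded by (rule spec)
    then obtain l D where l: "l\<^sub>0 < l" and D: "inj_on D {..<2 :: nat}" "D ` {..<2} \<subseteq> ?Y"
      "captured m n r \<F> 2 D l"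
      by (elim exE conjE CollectE) (rule that)
    have "0 \<in> {..<2 :: nat}" "1 \<in> {..<2 :: nat}" by simp_all
    then have "D 0 \<in> ?Y" "D 1 \<in> ?Y" using D(2) by blast+
    moreover have "D ` {..<2} \<subseteq> X" using D(2) by blast
    ultimately show False
      using inc[OF l D(1) _ D(3)] Xf(2) refl by auto
  qed
  then obtain Y where Y: "Y \<subseteq> X" "inj_on p Y" "uncountable Y"
    by (rule uncountable_image_inj_on)
  define s where "s = inv_into Y p"
  have ps: "p (s t) = t" "s t \<in> Y" if "t \<in> p ` Y" for t
    using that by (auto simp: s_def f_inv_into_f inv_into_into)
  show thesis
  proof (rule that)
    show "p ` Y \<subseteq> Field T" using Y(1) Xf(2) by blast
    show "uncountable (p ` Y)" using Y(2,3) countable_image_inj_on by blast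
    show "inj_on s (p ` Y)" using ps(1) by (metis inj_onI)
    show "finite (s t)" if "t \<in> p ` Y" for t using ps(2)[OF that] Y(1) Xf(1) by blast
    show "(t, u) \<notin> T \<and> (u, t) \<notin> T"
      if "l\<^sub>0 < l" "t \<in> p ` Y" "u \<in> p ` Y" "t \<noteq> u"
        "captured m n r \<F> 2 (\<lambda>i :: nat. if i = 0 then s t else s u) l" for l t u
    proof -
      have "s t \<noteq> s u" using ps(1)[OF that(2)] ps(1)[OF that(3)] that(4) by metis
      then have "inj_on (\<lambda>i :: nat. if i = 0 then s t else s u) {..<2}"
        by (auto simp: inj_on_def)
      then show ?thesis
        using inc[OF that(1) _ _ that(5)] ps[OF that(2)] ps[OF that(3)] Y(1) by auto
    qed
  qed
qed

section \<open>The two contradictory conclusions about the reversed tree\<close>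

text \<open>A linked set for the reversed tree that reaches all heights is a chain, but countable
  chains have bounded heights.\<close>

lemma not_capture_ccc_converse:
  fixes \<kappa> :: "'p set rel"
  assumes "capturing m n r \<F> 2" "uncountable (UNIV :: 'p set)"
    "is_m_scheme m n r \<F> \<kappa>" "cardSuc natLeq <o \<kappa>"
  shows "\<not> capture_ccc m n r \<F> (T\<inverse>)"
proof
  assume cc: "capture_ccc m n r \<F> (T\<inverse>)"
  let ?B = "\<lambda>a. {t \<in> Field T. a \<le> ht t}"
  obtain G where G: "G \<subseteq> Field (T\<inverse>)" "\<And>p q. p \<in> G \<Longrightarrow> q \<in> G \<Longrightarrow> compat (T\<inverse>) p q"
    "\<And>a. G \<inter> ?B a \<noteq> {}"
  proof (rule unbounded_linked_set[OF assms _ cc, where B = ?B])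
    show "Partial_order (T\<inverse>)" using po by simp
    show "|Field (T\<inverse>)| \<le>o |UNIV :: omega1 set|" using card_Field by simp
    show "?B a \<inter> Field (T\<inverse>) \<noteq> {}" for a
      using ht_unbounded[OF subset_refl uncountable_Field, of a] by auto
    show "?B b \<subseteq> ?B a" if "a \<le> b" for a b using that by auto
    show "s \<in> ?B a" if "q \<in> ?B a" "(s, q) \<in> T\<inverse>" for a s q
      using that ht_mono[of q s] by (auto intro: FieldI2)
  qed (rule that)
  have "G \<in> Chains T"
    unfolding Chains_def using G(1,2) compat_converse_iff by simp blast
  then have "countable (ht ` G)" using countable_chain by blast
  then obtain b where "\<And>a. a \<in> ht ` G \<Longrightarrow> a < b"
    by (rule countable_bounded_omega1) blast
  moreover obtain t where "t \<in> G" "b \<le> ht t" using G(3)[of b] by blast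
  ultimately show False by (meson imageI not_le)
qed

text \<open>Any two nodes in the union of a linked set of finite antichains lie in one antichain, so
  the union is an antichain. It reaches all heights and is therefore uncountable.\<close>

lemma capture_ccc_converse:
  fixes \<kappa> :: "'p set rel"
  assumes "capturing m n r \<F> 2" "uncountable (UNIV :: 'p set)"
    "is_m_scheme m n r \<F> \<kappa>" "cardSuc natLeq <o \<kappa>"
  shows "capture_ccc m n r \<F> (T\<inverse>)"
proof (rule ccontr)
  assume "\<not> capture_ccc m n r \<F> (T\<inverse>)"
  then obtain A s l\<^sub>0 where A: "A \<subseteq> Field T" "uncountable A"
    and s: "inj_on s A" "\<And>t. t \<in> A \<Longrightarrow> finite (s t)"
      "\<And>l t u. l\<^sub>0 < l \<Longrightarrow> t \<in> A \<Longrightarrow> u \<in> A \<Longrightarrow> t \<noteq> u \<Longrightarrow>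
        captured m n r \<F> 2 (\<lambda>i :: nat. if i = 0 then s t else s u) l \<Longrightarrow> (t, u) \<notin> T \<and> (u, t) \<notin> T"
    by (rule capture_obstruction[OF assms(1)]) blast
  have cc: "capture_ccc m n r \<F> (antichain_forcing A)"
    by (rule capture_ccc_antichain_forcing[OF assms(1) A(1) s])
  let ?B = "\<lambda>a. {q \<in> antichains A. \<exists>t\<in>q. a \<le> ht t}"
  obtain G where G: "G \<subseteq> antichains A" "\<And>p q. p \<in> G \<Longrightarrow> q \<in> G \<Longrightarrow> compat (antichain_forcing A) p q"
    "\<And>a. G \<inter> ?B a \<noteq> {}"
  proof (rule unbounded_linked_set[OF assms Partial_order_antichain_forcing cc, where B = ?B,
        unfolded Field_antichain_forcing])
    have "|{q. q \<subseteq> Field T \<and> finite q}| \<le>o |UNIV :: omega1 set|"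
      by (rule card_of_finite_subsets[OF infinite_omega1 card_Field])
    moreover have "|antichains A| \<le>o |{q. q \<subseteq> Field T \<and> finite q}|"
      using A(1) by (intro card_of_mono1) (auto simp: antichains_def)
    ultimately show "|antichains A| \<le>o |UNIV :: omega1 set|"
      using ordLeq_transitive by blast
    show "?B a \<inter> antichains A \<noteq> {}" for a
    proof -
      obtain t where "t \<in> A" "a \<le> ht t" by (rule ht_unbounded[OF A])
      then have "{t} \<in> ?B a" by (simp add: antichains_def)
      then show ?thesis by blast
    qed
    show "?B b \<subseteq> ?B a" if "a \<le> b" for a b using that order_trans by blast
    show "p \<in> ?B a" if "q \<in> ?B a" "(p, q) \<in> antichain_forcing A" for a p q
      using that unfolding antichain_forcing_def by blast
  qed (rule that)
  have "pairwise (\<lambda>s t. (s, t) \<notin> T) (\<Union>G)"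
  proof (rule pairwiseI)
    fix t u assume tu: "t \<in> \<Union>G" "u \<in> \<Union>G" "t \<noteq> u"
    then obtain p q where "p \<in> G" "t \<in> p" "q \<in> G" "u \<in> q" by blast
    then obtain q' where "q' \<in> antichains A" "t \<in> q'" "u \<in> q'"
      using G(2)[of p q] unfolding compat_def antichain_forcing_def by blast
    then show "(t, u) \<notin> T" using tu(3) unfolding antichains_def pairwise_def by blast
  qed
  moreover have "\<Union>G \<subseteq> Field T"
    using G(1) A(1) unfolding antichains_def by blast
  ultimately have "countable (ht ` \<Union>G)" using countable_antichain by blast
  then obtain b where "\<And>a. a \<in> ht ` \<Union>G \<Longrightarrow> a < b"
    by (rule countable_bounded_omega1) blast
  moreover obtain t where "t \<in> \<Union>G" "b \<le> ht t" using G(3)[of b] by blast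
  ultimately show False by (meson imageI not_le)
qed

end

theorem mainTheorem12:
  fixes m n r :: "nat \<Rightarrow> nat"
    and \<F> :: "omega1 set set"
    and \<kappa> :: "'p set rel"
  assumes "scheme_type m n r" and "good_type r"
    and "construction_scheme m n r \<F>"
    and "capturing m n r \<F> 2"
    and "uncountable (UNIV :: 'p set)"
    and "is_m_scheme m n r \<F> \<kappa>"
    and "cardSuc natLeq <o \<kappa>"
  shows "\<nexists>T :: 't rel. suslin_tree T"
proof
  assume "\<exists>T :: 't rel. suslin_tree T"
  then obtain T :: "'t rel" where "suslin_tree T" ..
  then interpret suslin T by unfold_locales
  show False
    using not_capture_ccc_converse[OF assms(4-7)] capture_ccc_converse[OF assms(4-7)] by blast
qed

end
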